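(* Let $a, b, p \in \mathbb{Q}$ with $p > 0$, $\sqrt{p} \notin \mathbb{Q}$ and $a + b\sqrt{p} > 0$. Let $M$ be a polygon all of whose side lengths belong to $\mathbb{Q}[\sqrt{p}]$, and suppose that $M$ can be dissected into equal (congruent) rectangles with side ratio $y \in \mathbb{R}$. Then: 1) If $a - b\sqrt{p} > 0$, then $M$ can be dissected into rectangles with side ratio $a + b\sqrt{p}$ if and only if $$y \in \left\{ e + f\sqrt{p} \;:\; e, f \in \mathbb{Q},\ e > 0,\ \frac{|f|}{e} \leqslant \frac{|b|}{a} \right\}.$$ 2) If $a - b\sqrt{p} < 0$, then $M$ can be dissected into rectangles with side ratio $a + b\sqrt{p}$ if and only if $$y \in \left\{ e + f\sqrt{p} \;:\; e, f \in \mathbb{Q},\ f > 0,\ \frac{|e|}{f} \leqslant \frac{|a|}{b} \right\}.$$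
   Context: $\mathbb{Q}[\sqrt{p}] = \{\alpha + \beta\sqrt{p} : \alpha, \beta \in \mathbb{Q}\}$. A polygon is a closed connected bounded part of the plane bounded by one or several pairwise disjoint non-self-intersecting closed polygonal lines (in particular, a polygon need not be simply connected). A dissection of a polygon into rectangles is a representation of it as a union of finitely many rectangles with pairwise disjoint interiors. A rectangle has side ratio $r$ if its side lengths are $s$ and $rs$ for some $s > 0$ (no matter in which order or orientation); the rectangles in a dissection into rectangles of a given side ratio may have different sizes. *)

theory Defs
  imports "HOL-Analysis.Analysis"
begin

definition rat_adjoin_sqrt :: "real \<Rightarrow> real set" where
  "rat_adjoin_sqrt p = {\<alpha> + \<beta> * sqrt p | \<alpha> \<beta>. \<alpha> \<in> \<rat> \<and> \<beta> \<in> \<rat>}"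

text \<open>
  A closed polygonal line is given by the cyclic list of its vertices: side number \<open>i\<close>
  joins vertex \<open>i\<close> to vertex \<open>i + 1\<close>, indices being taken modulo the length.
\<close>

definition side_ends :: "(real^2) list \<Rightarrow> nat \<Rightarrow> (real^2) \<times> (real^2)" where
  "side_ends vs i = (vs ! i, vs ! (Suc i mod length vs))"

definition side :: "(real^2) list \<Rightarrow> nat \<Rightarrow> (real^2) set" where
  "side vs i = closed_segment (fst (side_ends vs i)) (snd (side_ends vs i))"

definition side_length :: "(real^2) list \<Rightarrow> nat \<Rightarrow> real" where
  "side_length vs i = dist (fst (side_ends vs i)) (snd (side_ends vs i))"

definition polygonal_line :: "(real^2) list \<Rightarrow> (real^2) set" where
  "polygonal_line vs = (\<Union>i<length vs. side vs i)"

text \<open>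
  Non-self-intersecting: two different sides meet only in a common end point. Straight
  angles are excluded, so that the sides of the list are the sides of the polygon and
  not pieces of them; every polygon has such a list of vertices.
\<close>

definition simple_closed_polygonal_line :: "(real^2) list \<Rightarrow> bool" where
  "simple_closed_polygonal_line vs \<longleftrightarrow>
     length vs \<ge> 3 \<and> distinct vs \<and>
     (\<forall>i<length vs. \<forall>j<length vs. i \<noteq> j \<longrightarrow>
        side vs i \<inter> side vs j =
          {fst (side_ends vs i), snd (side_ends vs i)} \<inter>
          {fst (side_ends vs j), snd (side_ends vs j)}) \<and>
     (\<forall>i<length vs.
        \<not> collinear {vs ! i, vs ! (Suc i mod length vs), vs ! (Suc (Suc i) mod length vs)})"

text \<open>
  \<open>M\<close> is a polygon whose boundary consists of the polygonal lines in \<open>C\<close>. The equation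
  \<open>closure (interior M) = M\<close> says that \<open>M\<close> is a part of the plane; without it, a closed
  polygonal line, being its own frontier, would be a polygon.
\<close>

definition polygon_bounded_by :: "(real^2) list set \<Rightarrow> (real^2) set \<Rightarrow> bool" where
  "polygon_bounded_by C M \<longleftrightarrow>
     closed M \<and> connected M \<and> bounded M \<and> closure (interior M) = M \<and>
     finite C \<and> C \<noteq> {} \<and>
     (\<forall>vs\<in>C. simple_closed_polygonal_line vs) \<and>
     pairwise (\<lambda>vs ws. disjnt (polygonal_line vs) (polygonal_line ws)) C \<and>
     frontier M = (\<Union>vs\<in>C. polygonal_line vs)"

definition polygon_side_lengths :: "(real^2) list set \<Rightarrow> real set" where
  "polygon_side_lengths C = {side_length vs i | vs i. vs \<in> C \<and> i < length vs}"

text \<open>Rectangles may be rotated arbitrarily; \<open>u\<close>, \<open>v\<close> are the directions of the sides.\<close>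

definition rectangle :: "real \<Rightarrow> real \<Rightarrow> (real^2) set \<Rightarrow> bool" where
  "rectangle l w R \<longleftrightarrow> l > 0 \<and> w > 0 \<and>
     (\<exists>c u v. norm u = 1 \<and> norm v = 1 \<and> u \<bullet> v = 0 \<and>
        R = {c + s *\<^sub>R u + t *\<^sub>R v | s t. 0 \<le> s \<and> s \<le> l \<and> 0 \<le> t \<and> t \<le> w})"

definition has_side_ratio :: "real \<Rightarrow> (real^2) set \<Rightarrow> bool" where
  "has_side_ratio r R \<longleftrightarrow> (\<exists>s>0. rectangle s (r * s) R)"

definition congruent_sets :: "(real^2) set \<Rightarrow> (real^2) set \<Rightarrow> bool" where
  "congruent_sets A B \<longleftrightarrow>
     (\<exists>f :: real^2 \<Rightarrow> real^2. (\<forall>x y. dist (f x) (f y) = dist x y) \<and> f ` A = B)"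

definition rectangle_dissection :: "(real^2) set set \<Rightarrow> (real^2) set \<Rightarrow> bool" where
  "rectangle_dissection D M \<longleftrightarrow>
     finite D \<and> (\<forall>R\<in>D. \<exists>l w. rectangle l w R) \<and> \<Union>D = M \<and>
     pairwise (\<lambda>R S. interior R \<inter> interior S = {}) D"

definition dissectable_with_ratio :: "real \<Rightarrow> (real^2) set \<Rightarrow> bool" where
  "dissectable_with_ratio r M \<longleftrightarrow>
     (\<exists>D. rectangle_dissection D M \<and> (\<forall>R\<in>D. has_side_ratio r R))"

definition dissectable_into_equal_with_ratio :: "real \<Rightarrow> (real^2) set \<Rightarrow> bool" where
  "dissectable_into_equal_with_ratio r M \<longleftrightarrow>
     (\<exists>D. rectangle_dissection D M \<and> (\<forall>R\<in>D. has_side_ratio r R) \<and>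
          (\<forall>R\<in>D. \<forall>S\<in>D. congruent_sets R S))"

end

theory Submission imports Defs begin

text \<open>
  If \<open>f\<close> is an additive function on the reals, the sum of \<open>f l * f w\<close> over the \<open>l \<times> w\<close>
  rectangles of a dissection depends only on the dissected set: tiles of nonparallel directions
  share only finitely many points, so any two dissections induce the same partition of the set by
  directions, and for one direction one passes to a common grid. Hence a dissection into \<open>N\<close>
  copies of a \<open>w \<times> y w\<close> rectangle and one into \<open>s\<^sub>i \<times> x s\<^sub>i\<close> rectangles satisfy
  \<open>\<Sum>\<^sub>i f s\<^sub>i * f (x s\<^sub>i) = N * f w * f (y w)\<close>. For \<open>f\<close> linear over \<open>K = \<rat>[\<surd>p]\<close> the left-hand
  side is nonnegative, which forces \<open>y \<in> K\<close>. Taking for \<open>f\<close> a \<open>K\<close>-linear map, a map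
  semilinear with respect to conjugation, and their sum, the Cauchy--Schwarz inequality gives the
  bound on \<open>y\<close>.
  Conversely, the attainable ratios are closed under inversion, addition and multiplication by
  positive rationals, and \<open>1 / x\<close> is a rational multiple of the conjugate of \<open>x\<close>.
\<close>

section \<open>Additive functions on the reals\<close>

text \<open>One point is placed in every gap between consecutive elements of \<open>X\<close>,
  weighted by \<open>f\<close> of the length of the gap, and additivity telescopes. Since
  \<open>P\<close> avoids \<open>X\<close>, sample points never lie on grid lines. That each point
  of \<open>P\<close> lies below some element of \<open>X\<close> is carried along for the
  induction: a new maximum then adds exactly one gap beyond all earlier points.\<close>

lemma grid_sum_exists:
  fixes f :: "real \<Rightarrow> real"
  assumes "Modules.additive f" "finite X"
  shows "\<exists>P \<omega>. finite P \<and> P \<inter> X = {} \<and> (\<forall>m\<in>P. \<exists>x\<in>X. m < x) \<and>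
    (\<forall>a\<in>X. \<forall>b\<in>X. a \<le> b \<longrightarrow> f (b - a) = (\<Sum>m\<in>{m\<in>P. a < m \<and> m < b}. \<omega> m))"
  using assms(2)
proof (induction X rule: finite_linorder_max_induct)
  case empty
  then show ?case by (intro exI[of _ "{}"]) auto
next
  case (insert b A)
  note add = additive.add[OF assms(1)] and zero = additive.zero[OF assms(1)]
  obtain P \<omega> where P: "finite P" "P \<inter> A = {}" "\<forall>m\<in>P. \<exists>x\<in>A. m < x"
    and sum: "\<And>a a'. a \<in> A \<Longrightarrow> a' \<in> A \<Longrightarrow> a \<le> a' \<Longrightarrow>
       f (a' - a) = (\<Sum>m\<in>{m\<in>P. a < m \<and> m < a'}. \<omega> m)"
    using insert.IH by blast
  show ?case
  proof (cases "A = {}")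
    case True
    then show ?thesis using zero by (intro exI[of _ "{}"]) auto
  next
    case False
    define c where "c = Max A"
    have c: "c \<in> A" "\<And>x. x \<in> A \<Longrightarrow> x \<le> c" "c < b"
      using False insert.hyps by (auto simp: c_def)
    have Pc: "m < c" if "m \<in> P" for m using that P(3) c(2) by force
    define n where "n = (c + b) / 2"
    have n: "c < n" "n < b" using c(3) by (simp_all add: n_def)
    define \<omega>' where "\<omega>' m = (if m = n then f (b - c) else \<omega> m)" for m
    have nP: "n \<notin> P" using Pc n by force
    have "f (a' - a) = (\<Sum>m\<in>{m\<in>insert n P. a < m \<and> m < a'}. \<omega>' m)"
      if a: "a \<in> insert b A" "a' \<in> insert b A" "a \<le> a'" for a a'
    proof (cases "a' = b")
      case False
      then have A: "a \<in> A" "a' \<in> A" using a insert.hyps by force+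
      then have "{m\<in>insert n P. a < m \<and> m < a'} = {m\<in>P. a < m \<and> m < a'}" using c n by force
      moreover have "(\<Sum>m\<in>{m\<in>P. a < m \<and> m < a'}. \<omega>' m) = (\<Sum>m\<in>{m\<in>P. a < m \<and> m < a'}. \<omega> m)"
        using nP by (intro sum.cong) (auto simp: \<omega>'_def)
      ultimately show ?thesis using sum A a by simp
    next
      case True
      show ?thesis
      proof (cases "a = b")
        case True
        have "{m\<in>insert n P. b < m \<and> m < b} = {}" by auto
        then show ?thesis unfolding True \<open>a' = b\<close> by (simp only: sum.empty diff_self zero)
      next
        case False
        then have A: "a \<in> A" using a by simp
        have "{m\<in>insert n P. a < m \<and> m < b} = insert n {m\<in>P. a < m \<and> m < c}"
          using n c(3) c(2)[OF A] Pc by force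
        moreover have "(\<Sum>m\<in>{m\<in>P. a < m \<and> m < c}. \<omega>' m) = (\<Sum>m\<in>{m\<in>P. a < m \<and> m < c}. \<omega> m)"
          using nP by (intro sum.cong) (auto simp: \<omega>'_def)
        ultimately have "(\<Sum>m\<in>{m\<in>insert n P. a < m \<and> m < b}. \<omega>' m) = f (b - c) + f (c - a)"
          using sum[OF A c(1) c(2)[OF A]] nP P(1) by (simp add: \<omega>'_def)
        also have "\<dots> = f (b - a)" using add[of "b - c" "c - a"] by simp
        finally show ?thesis using \<open>a' = b\<close> by simp
      qed
    qed
    moreover have "insert n P \<inter> insert b A = {}"
      using P(2) n c Pc by force
    moreover have "\<forall>m\<in>insert n P. \<exists>x\<in>insert b A. m < x" using P(3) n by blast
    ultimately show ?thesis using P(1) by (intro exI[of _ "insert n P"] exI[of _ \<omega>']) auto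
  qed
qed

text \<open>A rationally independent set extends to a Hamel basis of the reals over the rationals,
  so the values of a rational-linear map on it can be prescribed. The coefficients are reals in
  \<open>\<rat>\<close>, which spares later computations the type \<open>rat\<close>.\<close>

lemma rat_linear_functional_exists:
  fixes B :: "real set" and g :: "real \<Rightarrow> real"
  assumes "finite B"
    and indep: "\<And>q. (\<And>b. b \<in> B \<Longrightarrow> q b \<in> \<rat>) \<Longrightarrow> (\<Sum>b\<in>B. q b * b) = 0 \<Longrightarrow> \<forall>b\<in>B. q b = 0"
  obtains h :: "real \<Rightarrow> real" where "Modules.additive h"
    "\<And>q x. q \<in> \<rat> \<Longrightarrow> h (q * x) = q * h x" "\<And>b. b \<in> B \<Longrightarrow> h b = g b"
proof -
  define scale where "scale q x = real_of_rat q * x" for q x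
  have V: "vector_space scale"
    by unfold_locales (simp_all add: scale_def algebra_simps of_rat_add of_rat_mult)
  then have VV: "vector_space_pair scale scale"
    by (simp add: vector_space_pair_def)
  have "\<not> module.dependent scale B"
  proof
    assume "module.dependent scale B"
    then obtain q v where q: "v \<in> B" "q v \<noteq> 0" "(\<Sum>b\<in>B. real_of_rat (q b) * b) = 0"
      unfolding module.dependent_finite[OF V[folded module_iff_vector_space] assms(1)] scale_def
      by blast
    have "\<forall>b\<in>B. real_of_rat (q b) = 0" by (rule indep) (simp_all add: q)
    then show False using q by simp
  qed
  from vector_space_pair.linear_independent_extend[OF VV this, of g] obtain h where
    h: "Vector_Spaces.linear scale scale h" and hB: "\<forall>b\<in>B. h b = g b" by blast
  have hom: "module_hom scale scale h" using h by (simp add: linear_iff_module_hom)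
  have "Modules.additive h" by (rule additive.intro) (rule module_hom.add[OF hom])
  moreover have "h (q * x) = q * h x" if "q \<in> \<rat>" for q x
    using that module_hom.scale[OF hom] by (auto elim: Rats_cases simp: scale_def)
  moreover have "h b = g b" if "b \<in> B" for b using hB that by blast
  ultimately show ?thesis by (rule that)
qed

section \<open>Arithmetic of the quadratic field and its semilinear maps\<close>

lemma rat_combination_sqrt_eq_0:
  assumes "sqrt p \<notin> \<rat>" "q \<in> \<rat>" "r \<in> \<rat>" "q + r * sqrt p = 0"
  shows "q = 0 \<and> r = 0"
proof -
  have "r = 0"
  proof (rule ccontr)
    assume "r \<noteq> 0"
    then have "sqrt p = - q / r" using assms(4) by (simp add: field_simps)
    then show False using assms by simp
  qed
  then show ?thesis using assms(4) by simp
qed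

lemma rat_adjoin_sqrt_divide:
  assumes "p \<in> \<rat>" "p > 0" "sqrt p \<notin> \<rat>" "x \<in> rat_adjoin_sqrt p" "y \<in> rat_adjoin_sqrt p"
  shows "x / y \<in> rat_adjoin_sqrt p"
proof (cases "y = 0")
  case True
  \<comment> \<open>Here \<open>x / 0 = 0\<close> by convention.\<close>
  then show ?thesis by (auto simp: rat_adjoin_sqrt_def intro!: exI[of _ 0])
next
  case False
  obtain a b c d where x: "x = a + b * sqrt p" "a \<in> \<rat>" "b \<in> \<rat>"
    and y: "y = c + d * sqrt p" "c \<in> \<rat>" "d \<in> \<rat>"
    using assms(4,5) by (auto simp: rat_adjoin_sqrt_def)
  have pp: "sqrt p * sqrt p = p" using assms(2) by simp
  \<comment> \<open>The norm of \<open>y\<close>, its product with its conjugate. It is rational and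
    nonzero, so division by \<open>y\<close> reduces to division by a rational.\<close>
  define n where "n = c * c - p * d * d"
  have n: "y * (c - d * sqrt p) = n"
    using pp by (simp add: y n_def algebra_simps)
  have "c - d * sqrt p \<noteq> 0"
    using rat_combination_sqrt_eq_0[OF assms(3) y(2), of "- d"] y False by auto
  then have "n \<noteq> 0" using n False by auto
  have "x / y = x * (c - d * sqrt p) / n"
    using n False \<open>c - d * sqrt p \<noteq> 0\<close> by (metis mult_divide_mult_cancel_right)
  also have "x * (c - d * sqrt p) = (a * c - b * d * p) + (b * c - a * d) * sqrt p"
    using pp by (simp add: x algebra_simps)
  also have "\<dots> / n = (a * c - b * d * p) / n + ((b * c - a * d) / n) * sqrt p"
    by (simp add: add_divide_distrib)
  finally have "x / y = (a * c - b * d * p) / n + ((b * c - a * d) / n) * sqrt p" .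
  moreover have "n \<in> \<rat>" using x y assms(1) by (simp add: n_def)
  then have "(a * c - b * d * p) / n \<in> \<rat>" "(b * c - a * d) / n \<in> \<rat>"
    using x y assms(1) by simp_all
  ultimately show ?thesis unfolding rat_adjoin_sqrt_def by blast
qed

text \<open>A \<open>\<rat>\<close>-linear map is turned into one that is linear over \<open>\<rat>[\<surd>p]\<close> (for \<open>r = \<surd>p\<close>), or
  semilinear with respect to conjugation (for \<open>r = -\<surd>p\<close>).\<close>

lemma semilinear_from_rat_linear:
  fixes h :: "real \<Rightarrow> real"
  assumes "Modules.additive h" "\<And>q x. q \<in> \<rat> \<Longrightarrow> h (q * x) = q * h x"
    and "p \<in> \<rat>" "p \<ge> 0" "r * r = p" "a \<in> \<rat>" "b \<in> \<rat>"
  defines "\<Phi> \<equiv> \<lambda>s. r * h s + h (sqrt p * s)"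
  shows "Modules.additive \<Phi>" "\<Phi> ((a + b * sqrt p) * s) = (a + b * r) * \<Phi> s"
proof -
  note h_add = additive.add[OF assms(1)]
  show "Modules.additive \<Phi>"
    by (rule additive.intro) (simp add: \<Phi>_def distrib_left h_add)
  have pp: "sqrt p * sqrt p = p" using assms(4) by simp
  have "h ((a + b * sqrt p) * s) = a * h s + b * h (sqrt p * s)"
    using assms(2)[OF assms(6), of s] assms(2)[OF assms(7), of "sqrt p * s"]
    by (simp add: distrib_right h_add mult.assoc)
  moreover have "h (sqrt p * ((a + b * sqrt p) * s)) = a * h (sqrt p * s) + b * (p * h s)"
  proof -
    have "sqrt p * ((a + b * sqrt p) * s) = a * (sqrt p * s) + b * ((sqrt p * sqrt p) * s)"
      by (simp add: algebra_simps)
    then show ?thesis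
      unfolding pp by (simp add: h_add assms(2,3,6,7))
  qed
  \<comment> \<open>Since \<open>p = r * r\<close>, multiplying the argument by
    \<open>sqrt p\<close> multiplies \<open>\<Phi>\<close> by \<open>r\<close>; the sign of
    \<open>r\<close> decides between linear and semilinear.\<close>
  ultimately have "\<Phi> ((a + b * sqrt p) * s) =
      r * (a * h s + b * h (sqrt p * s)) + (a * h (sqrt p * s) + b * (r * r * h s))"
    by (simp add: \<Phi>_def assms(5))
  then show "\<Phi> ((a + b * sqrt p) * s) = (a + b * r) * \<Phi> s"
    by (simp add: \<Phi>_def algebra_simps)
qed

section \<open>Restrictions on the ratio forced by the identities for additive functions\<close>

lemma sqrt_conj_product:
  assumes "p \<ge> 0"
  shows "(u + v * sqrt p) * (u - v * sqrt p) = u\<^sup>2 - p * v\<^sup>2"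
proof -
  have "sqrt p * sqrt p = p" using assms by simp
  then show ?thesis by (simp add: algebra_simps power2_eq_square)
qed

text \<open>If \<open>y\<close> were outside the field, 1 and \<open>y\<close> would be independent
  over it, and some map \<open>\<Phi>\<close> linear over the field would have
  \<open>\<Phi> 1 = 1\<close> and \<open>\<Phi> y = - 1\<close>. For this map the left-hand side is
  a positive multiple of a sum of squares, whereas the right-hand side is
  \<open>- N\<close>.\<close>

lemma in_field_if_sums_eq:
  fixes t :: "'i \<Rightarrow> real"
  assumes a: "a \<in> \<rat>" and b: "b \<in> \<rat>" and p: "p \<in> \<rat>" "p > 0" "sqrt p \<notin> \<rat>"
    and x_pos: "a + b * sqrt p > 0"
    and "N > 0" "y > 0"
    and sums: "\<And>f. Modules.additive f \<Longrightarrow>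
      (\<Sum>i\<in>I. f (t i) * f ((a + b * sqrt p) * t i)) = N * (f 1 * f y :: real)"
  shows "y \<in> rat_adjoin_sqrt p"
proof (rule ccontr)
  assume y: "y \<notin> rat_adjoin_sqrt p"
  have sqrt_sq: "sqrt p * sqrt p = p" using p(2) by simp
  have mem: "q + r * sqrt p \<in> rat_adjoin_sqrt p" if "q \<in> \<rat>" "r \<in> \<rat>" for q r
    using that by (auto simp: rat_adjoin_sqrt_def)
  have p1: "sqrt p \<noteq> 1" "sqrt p > 0" using p by auto
  have ne: "y \<noteq> 1" "y \<noteq> sqrt p" using mem[of 1 0] mem[of 0 1] y by auto
  have ne3: "sqrt p * y \<noteq> 1"
  proof
    assume "sqrt p * y = 1"
    then have "y = 1 / sqrt p" using p1 by (simp add: field_simps)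
    then show False using y rat_adjoin_sqrt_divide[OF p mem[of 1 0] mem[of 0 1]] by simp
  qed
  let ?B = "{1, sqrt p, y, sqrt p * y}"
  \<comment> \<open>Distinctness is what splits a sum over the set \<open>?B\<close> into four
    separate terms.\<close>
  have dist: "1 \<notin> {sqrt p, y, sqrt p * y}" "sqrt p \<notin> {y, sqrt p * y}" "y \<noteq> sqrt p * y"
    using p1 ne ne3 \<open>y > 0\<close> by auto
  have sumB: "(\<Sum>b\<in>?B. q b * b) = (q 1 + q (sqrt p) * sqrt p) + (q y + q (sqrt p * y) * sqrt p) * y"
    for q using dist by (simp add: algebra_simps)
  \<comment> \<open>As \<open>h\<close> vanishes at 1 and \<open>y\<close>, its values 1 and -1 at
    \<open>sqrt p\<close> and \<open>sqrt p * y\<close> become the values of \<open>\<Phi>\<close>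
    at 1 and \<open>y\<close>.\<close>
  obtain h where h: "Modules.additive h" "\<And>q x. q \<in> \<rat> \<Longrightarrow> h (q * x) = q * h x"
    "\<And>b. b \<in> ?B \<Longrightarrow> h b = (if b = sqrt p then 1 else if b = sqrt p * y then - 1 else 0)"
  proof (rule rat_linear_functional_exists[of ?B
        "\<lambda>b. if b = sqrt p then 1 else if b = sqrt p * y then - 1 else 0"])
    fix q assume q: "\<And>b. b \<in> ?B \<Longrightarrow> q b \<in> \<rat>" and sum0: "(\<Sum>b\<in>?B. q b * b) = 0"
    have qr: "q 1 \<in> \<rat>" "q (sqrt p) \<in> \<rat>" "q y \<in> \<rat>" "q (sqrt p * y) \<in> \<rat>" using q by auto
    let ?c = "q 1 + q (sqrt p) * sqrt p" and ?d = "q y + q (sqrt p * y) * sqrt p"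
    have cd: "?c + ?d * y = 0" using sum0 sumB by simp
    have d0: "?d = 0"
    proof (rule ccontr)
      assume "?d \<noteq> 0"
      then have "y = (- q 1 + (- q (sqrt p)) * sqrt p) / ?d" using cd by (simp add: field_simps)
      moreover have "(- q 1 + (- q (sqrt p)) * sqrt p) / ?d \<in> rat_adjoin_sqrt p"
        using qr by (intro rat_adjoin_sqrt_divide[OF p] mem) simp_all
      ultimately show False using y by simp
    qed
    then have "?c = 0" using cd by simp
    then show "\<forall>b\<in>?B. q b = 0"
      using rat_combination_sqrt_eq_0[OF p(3)] qr d0 by blast
  qed auto
  define \<Phi> where "\<Phi> s = sqrt p * h s + h (sqrt p * s)" for s
  have \<Phi>: "Modules.additive \<Phi>" "\<Phi> ((a + b * sqrt p) * s) = (a + b * sqrt p) * \<Phi> s" for s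
    using semilinear_from_rat_linear[OF h(1,2) p(1) _ sqrt_sq a b] p(2) unfolding \<Phi>_def by auto
  have "\<Phi> 1 = 1" "\<Phi> y = - 1"
    using h(3)[of 1] h(3)[of "sqrt p"] h(3)[of y] h(3)[of "sqrt p * y"] dist by (auto simp: \<Phi>_def)
  then have "(\<Sum>i\<in>I. \<Phi> (t i) * ((a + b * sqrt p) * \<Phi> (t i))) < 0"
    using sums[OF \<Phi>(1)] \<open>N > 0\<close> by (simp add: \<Phi>(2))
  moreover have "(\<Sum>i\<in>I. \<Phi> (t i) * ((a + b * sqrt p) * \<Phi> (t i))) \<ge> 0"
    using x_pos by (intro sum_nonneg) (simp add: mult.left_commute[of "\<Phi> _"])
  ultimately show False by simp
qed

text \<open>\<open>A\<close>, \<open>B\<close> and \<open>S\<close> are the sums of \<open>(F t\<^sub>i)\<^sup>2\<close>, \<open>(G t\<^sub>i)\<^sup>2\<close> and \<open>F t\<^sub>i * G t\<^sub>i\<close>, where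
  \<open>F\<close> is linear over \<open>\<rat>[\<surd>p]\<close>, \<open>G\<close> is semilinear with respect to conjugation, and
  \<open>F 1 = G 1 = 1\<close>.\<close>

lemma conjugate_sums:
  fixes t :: "'i \<Rightarrow> real"
  assumes a: "a \<in> \<rat>" and b: "b \<in> \<rat>" and p: "p \<in> \<rat>" "p > 0" "sqrt p \<notin> \<rat>"
    and e: "e \<in> \<rat>" and f: "f \<in> \<rat>"
    and sums: "\<And>g. Modules.additive g \<Longrightarrow>
      (\<Sum>i\<in>I. g (t i) * g ((a + b * sqrt p) * t i)) = N * (g 1 * g (e + f * sqrt p) :: real)"
  obtains A B S where "A \<ge> 0" "B \<ge> 0" "N * (e + f * sqrt p) = (a + b * sqrt p) * A"
    "N * (e - f * sqrt p) = (a - b * sqrt p) * B" "a * S = e * N" "S\<^sup>2 \<le> A * B"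
proof -
  have sqrt_sq: "sqrt p * sqrt p = p" using p(2) by simp
  have p1: "1 \<noteq> sqrt p" using p by auto
  obtain h where h: "Modules.additive h" "\<And>q x. q \<in> \<rat> \<Longrightarrow> h (q * x) = q * h x"
    "\<And>b. b \<in> {1, sqrt p} \<Longrightarrow> h b = (if b = sqrt p then 1 else 0)"
  proof (rule rat_linear_functional_exists[of "{1, sqrt p}" "\<lambda>b. if b = sqrt p then 1 else 0"])
    fix q assume q: "\<And>b. b \<in> {1, sqrt p} \<Longrightarrow> q b \<in> \<rat>" "(\<Sum>b\<in>{1, sqrt p}. q b * b) = 0"
    then show "\<forall>b\<in>{1, sqrt p}. q b = 0"
      using rat_combination_sqrt_eq_0[OF p(3), of "q 1" "q (sqrt p)"] p1 by simp
  qed auto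
  have h1: "h 1 = 0" "h (sqrt p) = 1" using h(3) p1 by auto
  define F where "F s = sqrt p * h s + h (sqrt p * s)" for s
  define G where "G s = (- sqrt p) * h s + h (sqrt p * s)" for s
  have F: "Modules.additive F" "F ((q + r * sqrt p) * s) = (q + r * sqrt p) * F s"
    if "q \<in> \<rat>" "r \<in> \<rat>" for q r s
    using semilinear_from_rat_linear[OF h(1,2) p(1) _ sqrt_sq that] p(2) unfolding F_def by auto
  have mm: "(- sqrt p) * (- sqrt p) = p" using sqrt_sq by simp
  have G: "Modules.additive G" "G ((q + r * sqrt p) * s) = (q + r * (- sqrt p)) * G s"
    if "q \<in> \<rat>" "r \<in> \<rat>" for q r s
    using semilinear_from_rat_linear[OF h(1,2) p(1) _ mm that] p(2) unfolding G_def by auto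
  have F1: "F 1 = 1" "G 1 = 1" by (simp_all add: F_def G_def h1)
  have Fy: "F (e + f * sqrt p) = e + f * sqrt p" "G (e + f * sqrt p) = e - f * sqrt p"
    using F(2)[OF e f, of 1] G(2)[OF e f, of 1] F1 by simp_all
  have FG: "Modules.additive (\<lambda>s. F s + G s)"
    using F(1)[OF a b] G(1)[OF a b] by (simp add: Modules.additive_def)
  define A where "A = (\<Sum>i\<in>I. (F (t i))\<^sup>2)"
  define B where "B = (\<Sum>i\<in>I. (G (t i))\<^sup>2)"
  define S where "S = (\<Sum>i\<in>I. F (t i) * G (t i))"
  have A: "N * (e + f * sqrt p) = (a + b * sqrt p) * A"
    using sums[OF F(1)[OF a b]] unfolding F(2)[OF a b] F1 Fy
    by (simp add: A_def sum_distrib_left power2_eq_square mult_ac)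
  have B: "N * (e - f * sqrt p) = (a - b * sqrt p) * B"
    using sums[OF G(1)[OF a b]] unfolding G(2)[OF a b] F1 Fy
    by (simp add: B_def sum_distrib_left power2_eq_square mult_ac)
  \<comment> \<open>Polarization: the two mixed products carry the coefficients
    \<open>a + b * sqrt p\<close> and \<open>a - b * sqrt p\<close>, which add up to
    \<open>2 * a\<close>. Subtracting the identities for \<open>F\<close> and \<open>G\<close> from
    that for \<open>F + G\<close> isolates \<open>S\<close>.\<close>
  have "(F (t i) + G (t i)) * (F ((a + b * sqrt p) * t i) + G ((a + b * sqrt p) * t i)) =
     (a + b * sqrt p) * (F (t i))\<^sup>2 + (a - b * sqrt p) * (G (t i))\<^sup>2 + 2 * a * (F (t i) * G (t i))" for i
    unfolding F(2)[OF a b] G(2)[OF a b] by (simp add: algebra_simps power2_eq_square)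
  then have "(a + b * sqrt p) * A + (a - b * sqrt p) * B + 2 * a * S = N * (2 * (2 * e))"
    using sums[OF FG] F1 Fy by (simp add: A_def B_def S_def sum.distrib sum_distrib_left)
  then have "2 * a * S = N * (2 * (2 * e)) - N * (e + f * sqrt p) - N * (e - f * sqrt p)"
    using A B by simp
  then have S: "a * S = e * N" by (simp add: algebra_simps)
  have "S\<^sup>2 \<le> A * B" unfolding S_def A_def B_def by (rule Cauchy_Schwarz_ineq_sum)
  moreover have "A \<ge> 0" "B \<ge> 0" by (simp_all add: A_def B_def sum_nonneg)
  ultimately show ?thesis using that A B S by blast
qed

text \<open>Let x', y' be the conjugates of x = \<open>a + b * sqrt p\<close> and \<open>y\<close>.
  The relation N y' = x' B with \<open>B \<ge> 0\<close> gives y' the sign of x'. Cauchy-Schwarz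
  bounds e N in terms of \<open>A * B\<close>, and the product of the relations for \<open>y\<close>
  and y' expresses \<open>A * B\<close> through the norms x x' and y y'. Eliminating
  \<open>A * B\<close> leaves an inequality between rationals.\<close>

lemma ratio_necessary:
  fixes t :: "'i \<Rightarrow> real"
  assumes a: "a \<in> \<rat>" and b: "b \<in> \<rat>" and p: "p \<in> \<rat>" "p > 0" "sqrt p \<notin> \<rat>"
    and x_pos: "a + b * sqrt p > 0"
    and N: "N > 0" and y: "y > 0"
    and sums: "\<And>g. Modules.additive g \<Longrightarrow>
      (\<Sum>i\<in>I. g (t i) * g ((a + b * sqrt p) * t i)) = N * (g 1 * g y :: real)"
  obtains e f where "e \<in> \<rat>" "f \<in> \<rat>" "y = e + f * sqrt p"
    "a - b * sqrt p > 0 \<Longrightarrow> e > 0 \<and> \<bar>f\<bar> / e \<le> \<bar>b\<bar> / a"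
    "a - b * sqrt p < 0 \<Longrightarrow> f > 0 \<and> \<bar>e\<bar> / f \<le> \<bar>a\<bar> / b"
proof -
  have "y \<in> rat_adjoin_sqrt p" using in_field_if_sums_eq[OF a b p x_pos N y sums] .
  then obtain e f where ef: "e \<in> \<rat>" "f \<in> \<rat>" "y = e + f * sqrt p"
    by (auto simp: rat_adjoin_sqrt_def)
  let ?x = "a + b * sqrt p" and ?x' = "a - b * sqrt p" and ?y' = "e - f * sqrt p"
  obtain A B S where AB: "A \<ge> 0" "B \<ge> 0" "N * y = ?x * A" "N * ?y' = ?x' * B"
    and S: "a * S = e * N" "S\<^sup>2 \<le> A * B"
    using conjugate_sums[OF a b p ef(1,2) sums[unfolded ef(3)]] ef(3) by metis
  have sp: "sqrt p > 0" using p by simp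
  \<comment> \<open>A vanishing conjugate would force \<open>e = f = 0\<close> and hence
    \<open>y = 0\<close>. This makes the signs found below strict.\<close>
  have y'0: "?y' \<noteq> 0"
    using rat_combination_sqrt_eq_0[OF p(3) ef(1), of "- f"] ef y by auto
  have "e\<^sup>2 * N\<^sup>2 = a\<^sup>2 * S\<^sup>2" using S(1) by (metis power_mult_distrib)
  also have "\<dots> \<le> a\<^sup>2 * (A * B)" using S(2) by (simp add: mult_left_mono)
  finally have eN: "e\<^sup>2 * N\<^sup>2 \<le> a\<^sup>2 * (A * B)" .
  have "(?x * A) * (?x' * B) = (N * y) * (N * ?y')" using AB by simp
  then have xy: "(?x * ?x') * (A * B) = N\<^sup>2 * (y * ?y')"
    by (simp add: power2_eq_square mult_ac)
  have nx: "?x * ?x' = a\<^sup>2 - p * b\<^sup>2" and ny: "y * ?y' = e\<^sup>2 - p * f\<^sup>2"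
    using sqrt_conj_product[of p] p(2) ef(3) by simp_all
  have N2: "N\<^sup>2 > 0" using N by simp
  have pos: "e > 0 \<and> \<bar>f\<bar> / e \<le> \<bar>b\<bar> / a" if x': "?x' > 0"
  proof -
    have "N * ?y' \<ge> 0" using AB x' by simp
    then have "?y' > 0" using N y'0 by (simp add: zero_le_mult_iff)
    then have e: "e > 0" using y ef(3) by simp
    have a0: "a > 0" using x' x_pos by simp
    \<comment> \<open>The Cauchy-Schwarz bound is multiplied by the positive norm of x so that
      \<open>xy\<close> can remove \<open>A * B\<close>. Once the norms are expanded, the terms
      \<open>a\<^sup>2 * e\<^sup>2\<close> cancel.\<close>
    have "N\<^sup>2 * (e\<^sup>2 * (?x * ?x')) = (e\<^sup>2 * N\<^sup>2) * (?x * ?x')" by (simp add: mult_ac)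
    also have "\<dots> \<le> a\<^sup>2 * (A * B) * (?x * ?x')"
      using eN x' x_pos by (intro mult_right_mono) simp_all
    also have "\<dots> = N\<^sup>2 * (a\<^sup>2 * (y * ?y'))" using xy by (simp add: mult_ac)
    finally have "e\<^sup>2 * (a\<^sup>2 - p * b\<^sup>2) \<le> a\<^sup>2 * (e\<^sup>2 - p * f\<^sup>2)"
      using N2 unfolding nx ny by simp
    then have "p * (f * a)\<^sup>2 \<le> p * (b * e)\<^sup>2" by (simp add: algebra_simps power_mult_distrib)
    then have "(f * a)\<^sup>2 \<le> (b * e)\<^sup>2" using p by simp
    then have "\<bar>f * a\<bar> \<le> \<bar>b * e\<bar>" by (simp add: abs_le_square_iff)
    then show ?thesis using e a0 by (simp add: field_simps abs_mult)
  qed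
  have neg: "f > 0 \<and> \<bar>e\<bar> / f \<le> \<bar>a\<bar> / b" if x': "?x' < 0"
  proof -
    have "N * ?y' \<le> 0" using AB x' by (simp add: mult_nonpos_nonneg)
    then have "?y' < 0" using N y'0 by (simp add: mult_le_0_iff)
    then have "f * sqrt p > 0" using y ef(3) by simp
    then have f: "f > 0" using sp by (simp add: zero_less_mult_iff)
    have "b * sqrt p > 0" using x' x_pos by simp
    then have b0: "b > 0" using sp by (simp add: zero_less_mult_iff)
    \<comment> \<open>The norm of x is now negative, so its negative is the factor; this exchanges
      the roles of rational and irrational parts in the final bound.\<close>
    have "N\<^sup>2 * (e\<^sup>2 * - (?x * ?x')) = (e\<^sup>2 * N\<^sup>2) * - (?x * ?x')" by (simp add: mult_ac)
    also have "\<dots> \<le> a\<^sup>2 * (A * B) * - (?x * ?x')"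
      using eN x' x_pos by (intro mult_right_mono) (simp_all add: mult_nonneg_nonpos)
    also have "\<dots> = - (a\<^sup>2 * ((?x * ?x') * (A * B)))" by (simp add: mult_ac)
    also have "\<dots> = N\<^sup>2 * (a\<^sup>2 * - (y * ?y'))" unfolding xy by (simp add: mult_ac)
    finally have "e\<^sup>2 * - (a\<^sup>2 - p * b\<^sup>2) \<le> a\<^sup>2 * - (e\<^sup>2 - p * f\<^sup>2)"
      using N2 unfolding nx ny by (simp only: mult_le_cancel_left_pos)
    then have "p * (e * b)\<^sup>2 \<le> p * (a * f)\<^sup>2" by (simp add: algebra_simps power_mult_distrib)
    then have "(e * b)\<^sup>2 \<le> (a * f)\<^sup>2" using p by simp
    then have "\<bar>e * b\<bar> \<le> \<bar>a * f\<bar>" by (simp add: abs_le_square_iff)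
    then show ?thesis using f b0 by (simp add: field_simps abs_mult)
  qed
  show ?thesis using that[OF ef] pos neg by blast
qed

section \<open>Rectangles in orthonormal coordinates\<close>

definition rot :: "real^2 \<Rightarrow> real^2" where
  "rot u = vector [- u$2, u$1]"

text \<open>A rectangle by coordinate inequalities, with \<open>l\<close> measured along
  \<open>u\<close> and \<open>w\<close> along \<open>rot u\<close>. Keeping \<open>u\<close>
  explicit lets tiles be compared by direction; \<open>norm u = 1\<close> is assumed
  separately.\<close>

definition tile :: "real^2 \<Rightarrow> real \<Rightarrow> real \<Rightarrow> (real^2) set \<Rightarrow> bool" where
  "tile u l w R \<longleftrightarrow> l > 0 \<and> w > 0 \<and>
     (\<exists>\<alpha> \<beta>. R = {z. \<alpha> \<le> z \<bullet> u \<and> z \<bullet> u \<le> \<alpha> + l \<and> \<beta> \<le> z \<bullet> rot u \<and> z \<bullet> rot u \<le> \<beta> + w})"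

lemma inner_2: "(x::real^2) \<bullet> y = x$1 * y$1 + x$2 * y$2"
  by (simp add: inner_vec_def sum_2)

lemma rot_nth [simp]: "rot u $ 1 = - u$2" "rot u $ 2 = u$1"
  by (simp_all add: rot_def)

lemma rot_rot: "rot (rot u) = - u"
  by (simp add: vec_eq_iff forall_2)

lemma rot_minus: "rot (- u) = - rot u"
  by (simp add: vec_eq_iff forall_2)

lemma norm_eq_1_iff_2: "norm (u::real^2) = 1 \<longleftrightarrow> u$1 * u$1 + u$2 * u$2 = 1"
  by (metis inner_2 norm_eq_1)

lemma norm_rot [simp]: "norm (rot u) = norm u"
  by (simp add: norm_eq_sqrt_inner inner_2)

lemma inner_rot_self [simp]: "u \<bullet> rot u = 0" "rot u \<bullet> u = 0"
  by (simp_all add: inner_2)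

lemma orthonormal_expansion:
  assumes "norm u = 1"
  shows "z = (z \<bullet> u) *\<^sub>R u + (z \<bullet> rot u) *\<^sub>R rot u"
proof -
  have e: "u$1 * u$1 + u$2 * u$2 = 1" using assms by (simp add: norm_eq_1_iff_2)
  have "z$1 = z$1 * (u$1 * u$1 + u$2 * u$2)" "z$2 = z$2 * (u$1 * u$1 + u$2 * u$2)"
    by (simp_all add: e)
  then show ?thesis by (simp add: vec_eq_iff forall_2 inner_2 algebra_simps)
qed

lemma orthonormal_coords:
  assumes "norm u = 1"
  shows "(s *\<^sub>R u + t *\<^sub>R rot u) \<bullet> u = s" "(s *\<^sub>R u + t *\<^sub>R rot u) \<bullet> rot u = t"
proof -
  have "u \<bullet> u = 1" "rot u \<bullet> rot u = 1"
    using assms by (metis norm_eq_1 norm_rot)+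
  then show "(s *\<^sub>R u + t *\<^sub>R rot u) \<bullet> u = s" "(s *\<^sub>R u + t *\<^sub>R rot u) \<bullet> rot u = t"
    by (simp_all add: inner_add_left)
qed

lemma inner_self_coords:
  assumes "norm u = 1"
  shows "z \<bullet> z = (z \<bullet> u)\<^sup>2 + (z \<bullet> rot u)\<^sup>2"
proof -
  have "z \<bullet> z = z \<bullet> ((z \<bullet> u) *\<^sub>R u + (z \<bullet> rot u) *\<^sub>R rot u)"
    using orthonormal_expansion[OF assms, of z] by simp
  then show ?thesis by (simp add: inner_add_right power2_eq_square)
qed

lemma orthonormal_cases:
  assumes "norm u = 1" "norm v = 1" "u \<bullet> v = 0"
  shows "v = rot u \<or> v = - rot u"
proof -
  have v: "v = (v \<bullet> rot u) *\<^sub>R rot u"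
    using orthonormal_expansion[OF assms(1), of v] assms(3) by (simp add: inner_commute)
  have "\<bar>v \<bullet> rot u\<bar> = 1"
    using arg_cong[OF v, of norm] assms by simp
  then have "v \<bullet> rot u = 1 \<or> v \<bullet> rot u = -1" by linarith
  then show ?thesis using v by force
qed

lemma tile_uminus:
  assumes "tile u l w R" shows "tile (- u) l w R"
proof -
  obtain \<alpha> \<beta> where "l > 0" "w > 0" and
    R: "R = {z. \<alpha> \<le> z \<bullet> u \<and> z \<bullet> u \<le> \<alpha> + l \<and> \<beta> \<le> z \<bullet> rot u \<and> z \<bullet> rot u \<le> \<beta> + w}"
    using assms by (auto simp: tile_def)
  have "R = {z. -\<alpha>-l \<le> z \<bullet> (-u) \<and> z \<bullet> (-u) \<le> (-\<alpha>-l) + l \<and>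
      -\<beta>-w \<le> z \<bullet> rot (-u) \<and> z \<bullet> rot (-u) \<le> (-\<beta>-w) + w}"
    unfolding R by (auto simp: rot_minus)
  with \<open>l > 0\<close> \<open>w > 0\<close> show ?thesis unfolding tile_def by blast
qed

lemma tile_rot:
  assumes "tile u l w R" shows "tile (rot u) w l R"
proof -
  obtain \<alpha> \<beta> where "l > 0" "w > 0" and
    R: "R = {z. \<alpha> \<le> z \<bullet> u \<and> z \<bullet> u \<le> \<alpha> + l \<and> \<beta> \<le> z \<bullet> rot u \<and> z \<bullet> rot u \<le> \<beta> + w}"
    using assms by (auto simp: tile_def)
  have "R = {z. \<beta> \<le> z \<bullet> rot u \<and> z \<bullet> rot u \<le> \<beta> + w \<and>
      -\<alpha>-l \<le> z \<bullet> rot (rot u) \<and> z \<bullet> rot (rot u) \<le> (-\<alpha>-l) + l}"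
    unfolding R by (auto simp: rot_rot)
  with \<open>l > 0\<close> \<open>w > 0\<close> show ?thesis unfolding tile_def by blast
qed

lemma tile_imp_rectangle:
  assumes "norm u = 1" "tile u l w R" shows "rectangle l w R"
proof -
  obtain \<alpha> \<beta> where "l > 0" "w > 0" and
    R: "R = {z. \<alpha> \<le> z \<bullet> u \<and> z \<bullet> u \<le> \<alpha> + l \<and> \<beta> \<le> z \<bullet> rot u \<and> z \<bullet> rot u \<le> \<beta> + w}"
    using assms by (auto simp: tile_def)
  let ?c = "\<alpha> *\<^sub>R u + \<beta> *\<^sub>R rot u"
  have "R = {?c + s *\<^sub>R u + t *\<^sub>R rot u | s t. 0 \<le> s \<and> s \<le> l \<and> 0 \<le> t \<and> t \<le> w}"
  proof (intro equalityI subsetI)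
    fix z assume "z \<in> R"
    moreover have "z = ?c + (z \<bullet> u - \<alpha>) *\<^sub>R u + (z \<bullet> rot u - \<beta>) *\<^sub>R rot u"
      using orthonormal_expansion[OF assms(1), of z] by (simp add: algebra_simps)
    ultimately show "z \<in> {?c + s *\<^sub>R u + t *\<^sub>R rot u | s t. 0 \<le> s \<and> s \<le> l \<and> 0 \<le> t \<and> t \<le> w}"
      unfolding R by force
  next
    fix z assume "z \<in> {?c + s *\<^sub>R u + t *\<^sub>R rot u | s t. 0 \<le> s \<and> s \<le> l \<and> 0 \<le> t \<and> t \<le> w}"
    then obtain s t where st: "0 \<le> s" "s \<le> l" "0 \<le> t" "t \<le> w" and
      "z = ?c + s *\<^sub>R u + t *\<^sub>R rot u" by blast
    then have "z = (\<alpha> + s) *\<^sub>R u + (\<beta> + t) *\<^sub>R rot u" by (simp add: algebra_simps)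
    then have "z \<bullet> u = \<alpha> + s" "z \<bullet> rot u = \<beta> + t"
      using orthonormal_coords[OF assms(1)] by simp_all
    then show "z \<in> R" using st by (simp add: R)
  qed
  then show ?thesis
    unfolding rectangle_def using assms(1) \<open>l > 0\<close> \<open>w > 0\<close>
    by (intro conjI exI[of _ ?c] exI[of _ u] exI[of _ "rot u"]) simp_all
qed

lemma rectangle_imp_tile:
  assumes "rectangle l w R" obtains u where "norm u = 1" "tile u l w R"
proof -
  obtain c u v where "l > 0" "w > 0" and u: "norm u = 1" and v: "norm v = 1" "u \<bullet> v = 0" and
    R: "R = {c + s *\<^sub>R u + t *\<^sub>R v | s t. 0 \<le> s \<and> s \<le> l \<and> 0 \<le> t \<and> t \<le> w}"
    using assms by (auto simp: rectangle_def)
  have "\<exists>d. R = {d + s *\<^sub>R u + t *\<^sub>R rot u | s t. 0 \<le> s \<and> s \<le> l \<and> 0 \<le> t \<and> t \<le> w}"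
    using orthonormal_cases[OF u v]
  proof
    assume "v = rot u" then show ?thesis using R by blast
  next
    assume v: "v = - rot u"
    \<comment> \<open>The base point moves to the corner \<open>c + w *\<^sub>R v\<close>, and
      \<open>t\<close> is replaced by \<open>w - t\<close>.\<close>
    have "R = {(c - w *\<^sub>R rot u) + s *\<^sub>R u + t *\<^sub>R rot u | s t. 0 \<le> s \<and> s \<le> l \<and> 0 \<le> t \<and> t \<le> w}"
      (is "_ = ?S")
    proof (intro equalityI subsetI)
      fix z assume "z \<in> R"
      then obtain s t where st: "0 \<le> s" "s \<le> l" "0 \<le> t" "t \<le> w" "z = c + s *\<^sub>R u + t *\<^sub>R v"
        unfolding R by blast
      then have "z = (c - w *\<^sub>R rot u) + s *\<^sub>R u + (w - t) *\<^sub>R rot u"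
        by (simp add: v algebra_simps)
      moreover have "0 \<le> w - t" "w - t \<le> w" using st by auto
      ultimately show "z \<in> ?S" using st by blast
    next
      fix z assume "z \<in> ?S"
      then obtain s t where st: "0 \<le> s" "s \<le> l" "0 \<le> t" "t \<le> w"
         "z = (c - w *\<^sub>R rot u) + s *\<^sub>R u + t *\<^sub>R rot u" by blast
      then have "z = c + s *\<^sub>R u + (w - t) *\<^sub>R v"
        by (simp add: v algebra_simps)
      moreover have "0 \<le> w - t" "w - t \<le> w" using st by auto
      ultimately show "z \<in> R" unfolding R using st by blast
    qed
    then show ?thesis by blast
  qed
  then obtain d where
    Rd: "R = {d + s *\<^sub>R u + t *\<^sub>R rot u | s t. 0 \<le> s \<and> s \<le> l \<and> 0 \<le> t \<and> t \<le> w}" by blast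
  let ?a = "d \<bullet> u" and ?b = "d \<bullet> rot u"
  have "R = {z. ?a \<le> z \<bullet> u \<and> z \<bullet> u \<le> ?a + l \<and> ?b \<le> z \<bullet> rot u \<and> z \<bullet> rot u \<le> ?b + w}"
  proof (intro equalityI subsetI)
    fix z assume "z \<in> R"
    then obtain s t where st: "0 \<le> s" "s \<le> l" "0 \<le> t" "t \<le> w"
      "z = d + (s *\<^sub>R u + t *\<^sub>R rot u)" unfolding Rd by (auto simp: add.assoc)
    then have "z \<bullet> u = ?a + s" "z \<bullet> rot u = ?b + t"
      using orthonormal_coords[OF u] by (simp_all add: inner_add_left)
    then show "z \<in> {z. ?a \<le> z \<bullet> u \<and> z \<bullet> u \<le> ?a + l \<and> ?b \<le> z \<bullet> rot u \<and> z \<bullet> rot u \<le> ?b + w}"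
      using st by simp
  next
    fix z assume z: "z \<in> {z. ?a \<le> z \<bullet> u \<and> z \<bullet> u \<le> ?a + l \<and> ?b \<le> z \<bullet> rot u \<and> z \<bullet> rot u \<le> ?b + w}"
    have "z = d + (z \<bullet> u - ?a) *\<^sub>R u + (z \<bullet> rot u - ?b) *\<^sub>R rot u"
      using orthonormal_expansion[OF u, of "z - d"] by (simp add: algebra_simps)
    moreover have "0 \<le> z \<bullet> u - ?a" "z \<bullet> u - ?a \<le> l" "0 \<le> z \<bullet> rot u - ?b" "z \<bullet> rot u - ?b \<le> w"
      using z by auto
    ultimately show "z \<in> R" unfolding Rd by blast
  qed
  with \<open>l > 0\<close> \<open>w > 0\<close> have "tile u l w R" unfolding tile_def by blast
  with u show ?thesis by (rule that)
qed

lemma interior_tile: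
  assumes "norm u = 1"
  shows "interior {z. \<alpha> \<le> z \<bullet> u \<and> z \<bullet> u \<le> \<gamma> \<and> \<beta> \<le> z \<bullet> rot u \<and> z \<bullet> rot u \<le> \<delta>} =
         {z. \<alpha> < z \<bullet> u \<and> z \<bullet> u < \<gamma> \<and> \<beta> < z \<bullet> rot u \<and> z \<bullet> rot u < \<delta>}"
proof -
  have n: "u \<noteq> 0" "rot u \<noteq> 0" using assms norm_rot[of u] by (auto simp del: norm_rot)
  have h: "interior {z. c \<le> z \<bullet> e} = {z. c < z \<bullet> e}" "interior {z. z \<bullet> e \<le> c} = {z. z \<bullet> e < c}"
    if "e \<noteq> 0" for c and e :: "real^2"
    using interior_halfspace_ge[OF that, of c] interior_halfspace_le[OF that, of c]
    by (simp_all add: inner_commute[of e])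
  show ?thesis unfolding Collect_conj_eq interior_Int h[OF n(1)] h[OF n(2)] ..
qed

lemma tile_sets:
  assumes "norm u = 1" "tile u l w R"
  shows "closed R" "bounded R" "interior R \<noteq> {}" "closure (interior R) = R"
proof -
  obtain \<alpha> \<beta> where lw: "l > 0" "w > 0" and
    R: "R = {z. \<alpha> \<le> z \<bullet> u \<and> z \<bullet> u \<le> \<alpha> + l \<and> \<beta> \<le> z \<bullet> rot u \<and> z \<bullet> rot u \<le> \<beta> + w}"
    using assms by (auto simp: tile_def)
  have R': "R = {z. u \<bullet> z \<ge> \<alpha>} \<inter> {z. u \<bullet> z \<le> \<alpha> + l} \<inter> {z. rot u \<bullet> z \<ge> \<beta>} \<inter> {z. rot u \<bullet> z \<le> \<beta> + w}"
    by (auto simp: R inner_commute)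
  show cl: "closed R"
    unfolding R' by (intro closed_Int closed_halfspace_le closed_halfspace_ge)
  have cv: "convex R"
    unfolding R' by (intro convex_Int convex_halfspace_le convex_halfspace_ge)
  have "norm z \<le> (\<bar>\<alpha>\<bar> + l) + (\<bar>\<beta>\<bar> + w)" if "z \<in> R" for z
  proof -
    have "norm z \<le> norm ((z \<bullet> u) *\<^sub>R u) + norm ((z \<bullet> rot u) *\<^sub>R rot u)"
      using orthonormal_expansion[OF assms(1), of z] norm_triangle_ineq by metis
    also have "\<dots> = \<bar>z \<bullet> u\<bar> + \<bar>z \<bullet> rot u\<bar>" using assms by simp
    also have "\<dots> \<le> (\<bar>\<alpha>\<bar> + l) + (\<bar>\<beta>\<bar> + w)" using that lw unfolding R by auto
    finally show ?thesis .
  qed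
  then show "bounded R" by (auto simp: bounded_iff)
  have "(\<alpha> + l/2) *\<^sub>R u + (\<beta> + w/2) *\<^sub>R rot u \<in> interior R"
    unfolding R interior_tile[OF assms(1)] using lw orthonormal_coords[OF assms(1)] by simp
  then show ne: "interior R \<noteq> {}" by blast
  show "closure (interior R) = R"
    using convex_closure_interior[OF cv ne] cl by simp
qed

section \<open>Exchange of sides and congruence of rectangles\<close>

lemma rectangle_commute:
  assumes "rectangle l w R" shows "rectangle w l R"
proof -
  obtain u where u: "norm u = 1" "tile u l w R" using rectangle_imp_tile[OF assms] .
  have "norm (rot u) = 1" "tile (rot u) w l R" using u tile_rot by simp_all
  then show ?thesis by (rule tile_imp_rectangle)
qed

text \<open>An isometry carries opposite corners of \<open>R\<close> to two points of
  \<open>S\<close> at the same distance, and no two points of \<open>S\<close> are farther apart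
  than its diagonal.\<close>

lemma congruent_tiles_diagonal_le:
  assumes "norm u = 1" "tile u l w R" "norm v = 1" "tile v l' w' S" "congruent_sets R S"
  shows "l\<^sup>2 + w\<^sup>2 \<le> l'\<^sup>2 + w'\<^sup>2"
proof -
  obtain \<alpha> \<beta> where lw: "l > 0" "w > 0" and
    R: "R = {z. \<alpha> \<le> z \<bullet> u \<and> z \<bullet> u \<le> \<alpha> + l \<and> \<beta> \<le> z \<bullet> rot u \<and> z \<bullet> rot u \<le> \<beta> + w}"
    using assms by (auto simp: tile_def)
  obtain \<gamma> \<delta> where lw': "l' > 0" "w' > 0" and
    S: "S = {z. \<gamma> \<le> z \<bullet> v \<and> z \<bullet> v \<le> \<gamma> + l' \<and> \<delta> \<le> z \<bullet> rot v \<and> z \<bullet> rot v \<le> \<delta> + w'}"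
    using assms by (auto simp: tile_def)
  obtain f where f: "\<And>x y. dist (f x) (f y) = dist x y" "f ` R = S"
    using assms(5) by (auto simp: congruent_sets_def)
  define x where "x = \<alpha> *\<^sub>R u + \<beta> *\<^sub>R rot u"
  define y where "y = (\<alpha> + l) *\<^sub>R u + (\<beta> + w) *\<^sub>R rot u"
  have xy: "x \<in> R" "y \<in> R"
    using lw orthonormal_coords[OF assms(1)] by (auto simp: R x_def y_def)
  have sq: "(dist z z')\<^sup>2 = (z \<bullet> e - z' \<bullet> e)\<^sup>2 + (z \<bullet> rot e - z' \<bullet> rot e)\<^sup>2"
    if "norm e = 1" for z z' e :: "real^2"
    using inner_self_coords[OF that, of "z - z'"]
    by (simp add: dist_norm power2_norm_eq_inner inner_diff_left)
  have "l\<^sup>2 + w\<^sup>2 = (dist x y)\<^sup>2"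
    using sq[OF assms(1), of x y] orthonormal_coords[OF assms(1)] by (simp add: x_def y_def)
  also have "\<dots> = (dist (f x) (f y))\<^sup>2" by (simp add: f)
  also have "\<dots> \<le> l'\<^sup>2 + w'\<^sup>2"
  proof -
    have fxy: "f x \<in> S" "f y \<in> S" using xy f by auto
    have "\<bar>f x \<bullet> v - f y \<bullet> v\<bar> \<le> l'"
      using fxy unfolding S mem_Collect_eq by linarith
    moreover have "\<bar>f x \<bullet> rot v - f y \<bullet> rot v\<bar> \<le> w'"
      using fxy unfolding S mem_Collect_eq by linarith
    ultimately have "(f x \<bullet> v - f y \<bullet> v)\<^sup>2 \<le> l'\<^sup>2" "(f x \<bullet> rot v - f y \<bullet> rot v)\<^sup>2 \<le> w'\<^sup>2"
      using lw' by (metis abs_le_square_iff abs_of_pos)+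
    then show ?thesis using sq[OF assms(3), of "f x" "f y"] by linarith
  qed
  finally show ?thesis .
qed

text \<open>For a fixed ratio the diagonal determines the sides, so comparing diagonals suffices.
  Equality follows by using congruence both ways.\<close>

lemma congruent_same_ratio_sides_le:
  assumes "rectangle s (r * s) R" "rectangle t (r * t) S" "congruent_sets R S"
  shows "s \<le> t"
proof -
  obtain u where u: "norm u = 1" "tile u s (r * s) R" using rectangle_imp_tile[OF assms(1)] .
  obtain v where v: "norm v = 1" "tile v t (r * t) S" using rectangle_imp_tile[OF assms(2)] .
  have "s\<^sup>2 + (r * s)\<^sup>2 \<le> t\<^sup>2 + (r * t)\<^sup>2"
    using congruent_tiles_diagonal_le[OF u v assms(3)] .
  then have "(1 + r\<^sup>2) * s\<^sup>2 \<le> (1 + r\<^sup>2) * t\<^sup>2" by (simp add: algebra_simps power_mult_distrib)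
  moreover have "1 + r\<^sup>2 > 0" by (simp add: add_pos_nonneg)
  ultimately have "s\<^sup>2 \<le> t\<^sup>2" by simp
  moreover have "t \<ge> 0" using assms(2) by (simp add: rectangle_def)
  ultimately show ?thesis by (rule power2_le_imp_le)
qed

section \<open>Attainable ratios\<close>

text \<open>The dissections of the pieces are merged. Tiles from different pieces inherit disjoint
  interiors, since \<open>interior\<close> is monotone.\<close>

lemma dissectable_Union:
  assumes "finite \<R>" "\<And>R. R \<in> \<R> \<Longrightarrow> dissectable_with_ratio r R"
    and "pairwise (\<lambda>R S. interior R \<inter> interior S = {}) \<R>"
  shows "dissectable_with_ratio r (\<Union>\<R>)"
proof -
  obtain \<D> where D: "\<And>R. R \<in> \<R> \<Longrightarrow> rectangle_dissection (\<D> R) R"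
    "\<And>R S. R \<in> \<R> \<Longrightarrow> S \<in> \<D> R \<Longrightarrow> has_side_ratio r S"
    using assms(2) unfolding dissectable_with_ratio_def by metis
  have sub: "interior S \<subseteq> interior R" if "R \<in> \<R>" "S \<in> \<D> R" for R S
    using D(1)[OF that(1)] that(2) by (auto simp: rectangle_dissection_def intro!: interior_mono)
  have "rectangle_dissection (\<Union>R\<in>\<R>. \<D> R) (\<Union>\<R>)"
    unfolding rectangle_dissection_def
  proof (intro conjI)
    show "finite (\<Union>R\<in>\<R>. \<D> R)"
      using assms(1) D(1) by (auto simp: rectangle_dissection_def)
    show "\<forall>S\<in>\<Union>R\<in>\<R>. \<D> R. \<exists>l w. rectangle l w S"
      using D(1) by (auto simp: rectangle_dissection_def)
    have "\<Union> (\<D> R) = R" if "R \<in> \<R>" for R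
      using D(1)[OF that] by (simp add: rectangle_dissection_def)
    then show "\<Union> (\<Union>R\<in>\<R>. \<D> R) = \<Union> \<R>" by fastforce
    show "pairwise (\<lambda>R S. interior R \<inter> interior S = {}) (\<Union>R\<in>\<R>. \<D> R)"
    proof (rule pairwiseI)
      fix S T assume S: "S \<in> (\<Union>R\<in>\<R>. \<D> R)" and T: "T \<in> (\<Union>R\<in>\<R>. \<D> R)" and ne: "S \<noteq> T"
      obtain R R' where R: "R \<in> \<R>" "S \<in> \<D> R" and R': "R' \<in> \<R>" "T \<in> \<D> R'" using S T by blast
      show "interior S \<inter> interior T = {}"
      proof (cases "R = R'")
        case True
        then show ?thesis
          using D(1)[OF R(1)] R R' ne by (auto simp: rectangle_dissection_def pairwise_def)
      next
        case False
        then have "interior R \<inter> interior R' = {}"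
          using assms(3) R R' by (auto simp: pairwise_def)
        then show ?thesis using sub[OF R] sub[OF R'] by blast
      qed
    qed
  qed
  moreover have "\<forall>S\<in>\<Union>R\<in>\<R>. \<D> R. has_side_ratio r S" using D(2) by blast
  ultimately show ?thesis unfolding dissectable_with_ratio_def by blast
qed

text \<open>All sizes and positions are quantified over, so that attainability applies to the parts
  into which a larger rectangle is cut.\<close>

definition ratio_attainable :: "real \<Rightarrow> real \<Rightarrow> bool" where
  "ratio_attainable x r \<longleftrightarrow> r > 0 \<and> (\<forall>l R. rectangle l (r * l) R \<longrightarrow> dissectable_with_ratio x R)"

lemma ratio_attainable_self: assumes "x > 0" shows "ratio_attainable x x"
proof -
  have "dissectable_with_ratio x R" if "rectangle l (x * l) R" for l R
  proof -
    have "l > 0" using that by (simp add: rectangle_def)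
    then have "rectangle_dissection {R} R \<and> (\<forall>S\<in>{R}. has_side_ratio x S)"
      using that by (auto simp: rectangle_dissection_def has_side_ratio_def)
    then show ?thesis unfolding dissectable_with_ratio_def by blast
  qed
  then show ?thesis using assms by (simp add: ratio_attainable_def)
qed

lemma ratio_attainable_inverse:
  assumes "ratio_attainable x r" shows "ratio_attainable x (1 / r)"
proof -
  have r: "r > 0" using assms by (simp add: ratio_attainable_def)
  have "dissectable_with_ratio x R" if "rectangle l (1 / r * l) R" for l R
  proof -
    have "rectangle (1 / r * l) (r * (1 / r * l)) R"
      using rectangle_commute[OF that] r by simp
    then show ?thesis using assms unfolding ratio_attainable_def by blast
  qed
  then show ?thesis using r by (simp add: ratio_attainable_def)
qed

text \<open>A cut parallel to the side \<open>l\<close> leaves two rectangles that share this side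
  and have ratios \<open>r\<close> and \<open>s\<close>.\<close>

lemma ratio_attainable_add:
  assumes "ratio_attainable x r" "ratio_attainable x s" shows "ratio_attainable x (r + s)"
proof -
  have rs: "r > 0" "s > 0" using assms by (simp_all add: ratio_attainable_def)
  have "dissectable_with_ratio x R" if rect: "rectangle l ((r + s) * l) R" for l R
  proof -
    obtain u where u: "norm u = 1" "tile u l ((r + s) * l) R" using rectangle_imp_tile[OF rect] .
    obtain \<alpha> \<beta> where l: "l > 0" and
      R: "R = {z. \<alpha> \<le> z \<bullet> u \<and> z \<bullet> u \<le> \<alpha> + l \<and> \<beta> \<le> z \<bullet> rot u \<and> z \<bullet> rot u \<le> \<beta> + (r + s) * l}"
      using u(2) by (auto simp: tile_def)
    define A where
      "A = {z. \<alpha> \<le> z \<bullet> u \<and> z \<bullet> u \<le> \<alpha> + l \<and> \<beta> \<le> z \<bullet> rot u \<and> z \<bullet> rot u \<le> \<beta> + r * l}"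
    define B where
      "B = {z. \<alpha> \<le> z \<bullet> u \<and> z \<bullet> u \<le> \<alpha> + l \<and> \<beta> + r * l \<le> z \<bullet> rot u \<and> z \<bullet> rot u \<le> (\<beta> + r * l) + s * l}"
    have pos: "r * l > 0" "s * l > 0" using rs l by simp_all
    have "tile u l (r * l) A" "tile u l (s * l) B"
      using l pos unfolding tile_def A_def B_def by blast+
    then have "dissectable_with_ratio x A" "dissectable_with_ratio x B"
      using assms tile_imp_rectangle[OF u(1)] unfolding ratio_attainable_def by blast+
    moreover have "interior A \<inter> interior B = {}"
      unfolding A_def B_def interior_tile[OF u(1)] by auto
    ultimately have "dissectable_with_ratio x (\<Union>{A, B})"
      by (intro dissectable_Union) (auto simp: pairwise_insert Int_commute)
    moreover have "\<Union>{A, B} = R"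
      using pos by (auto simp: A_def B_def R algebra_simps)
    ultimately show ?thesis by simp
  qed
  then show ?thesis using rs by (simp add: ratio_attainable_def)
qed

text \<open>Repeated addition gives integer multiples, and inversion turns them into fractions:
  (m/n) r = m / (n / r).\<close>

lemma ratio_attainable_rat_mult:
  assumes "ratio_attainable x r" "q \<in> \<rat>" "q > 0" shows "ratio_attainable x (q * r)"
proof -
  have nat_mult: "ratio_attainable x (real (Suc n) * s)" if "ratio_attainable x s" for n s
  proof (induction n)
    case 0 then show ?case using that by simp
  next
    case (Suc n)
    then show ?case using ratio_attainable_add[OF Suc that] by (simp add: algebra_simps)
  qed
  obtain m n where mn: "n \<noteq> 0" "\<bar>q\<bar> = real m / real n"
    by (rule Rats_abs_nat_div_natE[OF assms(2)])
  then have "m \<noteq> 0" using assms(3) by (cases "m = 0") auto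
  then obtain m' n' where s: "m = Suc m'" "n = Suc n'" using mn(1) by (metis not0_implies_Suc)
  have "ratio_attainable x (real n * (1 / r))"
    using nat_mult[OF ratio_attainable_inverse[OF assms(1)]] s by simp
  then have "ratio_attainable x (real m * (1 / (real n * (1 / r))))"
    using nat_mult[OF ratio_attainable_inverse] s by blast
  moreover have "real m * (1 / (real n * (1 / r))) = q * r"
    using mn assms(3) by simp
  ultimately show ?thesis by simp
qed

lemma ratio_attainable_rat_combination:
  assumes "ratio_attainable x r" "ratio_attainable x s" "\<alpha> \<in> \<rat>" "\<beta> \<in> \<rat>" "\<alpha> \<ge> 0" "\<beta> \<ge> 0"
    "\<alpha> * r + \<beta> * s > 0"
  shows "ratio_attainable x (\<alpha> * r + \<beta> * s)"
proof -
  have r: "ratio_attainable x (\<alpha> * r)" if "\<alpha> \<noteq> 0"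
    using ratio_attainable_rat_mult[OF assms(1,3)] assms(5) that by simp
  have s: "ratio_attainable x (\<beta> * s)" if "\<beta> \<noteq> 0"
    using ratio_attainable_rat_mult[OF assms(2,4)] assms(6) that by simp
  \<comment> \<open>Attainable ratios are positive, so a summand with coefficient 0 has to be
    dropped rather than added.\<close>
  consider "\<alpha> = 0" "\<beta> \<noteq> 0" | "\<alpha> \<noteq> 0" "\<beta> = 0" | "\<alpha> \<noteq> 0" "\<beta> \<noteq> 0"
    using assms(7) by force
  then show ?thesis
    by cases (use r s ratio_attainable_add[OF r s] in simp_all)
qed

text \<open>The norm of x is a positive rational, so the conjugate of x, being the norm times 1/x,
  is attainable. The bound on \<open>f\<close> says exactly that the target is a combination of x
  and its conjugate with nonnegative rational coefficients.\<close>

lemma ratio_attainable_if_conj_pos: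
  assumes a: "a \<in> \<rat>" and b: "b \<in> \<rat>" and p: "p \<in> \<rat>" "p > 0" "sqrt p \<notin> \<rat>"
    and x_pos: "a + b * sqrt p > 0"
    and x': "a - b * sqrt p > 0" and ef: "e \<in> \<rat>" "f \<in> \<rat>" and e_pos: "e > 0"
    and le: "\<bar>f\<bar> / e \<le> \<bar>b\<bar> / a" and y_pos: "e + f * sqrt p > 0"
  shows "ratio_attainable (a + b * sqrt p) (e + f * sqrt p)"
proof -
  let ?x = "a + b * sqrt p" and ?x' = "a - b * sqrt p"
  have a0: "a > 0" using x' x_pos by simp
  have "ratio_attainable ?x ((a\<^sup>2 - p * b\<^sup>2) * (1 / ?x))"
  proof (rule ratio_attainable_rat_mult)
    show "ratio_attainable ?x (1 / ?x)"
      using ratio_attainable_inverse ratio_attainable_self x_pos by blast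
    show "a\<^sup>2 - p * b\<^sup>2 \<in> \<rat>" using a b p by simp
    show "a\<^sup>2 - p * b\<^sup>2 > 0" using mult_pos_pos[OF x_pos x'] sqrt_conj_product[of p a b] p(2) by simp
  qed
  moreover have "(a\<^sup>2 - p * b\<^sup>2) * (1 / ?x) = ?x'"
    using x_pos sqrt_conj_product[of p a b, symmetric] p(2) by simp
  ultimately have att: "ratio_attainable ?x ?x'" by simp
  have fe: "\<bar>f\<bar> * a \<le> \<bar>b\<bar> * e" using e_pos le a0 by (simp add: field_simps)
  \<comment> \<open>Comparing rational and irrational parts asks for
    \<open>\<alpha> + \<beta> = e / a\<close> and \<open>\<alpha> - \<beta> = f / b\<close>.\<close>
  define \<alpha> \<beta> where "\<alpha> = (e / a + f / b) / 2" and "\<beta> = (e / a - f / b) / 2"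
  have "\<bar>f / b\<bar> \<le> e / a"
  proof (cases "b = 0")
    case False
    then show ?thesis using fe a0 by (simp add: field_simps abs_divide)
  qed (use e_pos a0 in simp)
  then have "\<alpha> \<ge> 0 \<and> \<beta> \<ge> 0" unfolding \<alpha>_def \<beta>_def abs_le_iff by auto
  then have nn: "\<alpha> \<ge> 0" "\<beta> \<ge> 0" by auto
  \<comment> \<open>If \<open>b = 0\<close>, then \<open>fe\<close> forces \<open>f = 0\<close>, so
    the convention \<open>f / 0 = 0\<close> does no harm.\<close>
  have "(f / b) * b = f"
    using fe a0 by (cases "b = 0") (simp_all add: mult_le_0_iff)
  then have "(e / a) * a + (f / b) * b * sqrt p = e + f * sqrt p" using a0 by simp
  moreover have "\<alpha> * ?x + \<beta> * ?x' = (e / a) * a + (f / b) * b * sqrt p"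
  proof -
    have "\<alpha> + \<beta> = e / a" "\<alpha> - \<beta> = f / b" by (simp_all add: \<alpha>_def \<beta>_def field_simps)
    moreover have "\<alpha> * ?x + \<beta> * ?x' = (\<alpha> + \<beta>) * a + (\<alpha> - \<beta>) * b * sqrt p"
      by (simp add: algebra_simps)
    ultimately show ?thesis by simp
  qed
  ultimately have eq: "\<alpha> * ?x + \<beta> * ?x' = e + f * sqrt p" by simp
  have "ratio_attainable ?x (\<alpha> * ?x + \<beta> * ?x')"
    using ratio_attainable_self[OF x_pos] att
    by (rule ratio_attainable_rat_combination) (use a b ef y_pos nn eq in \<open>simp_all add: \<alpha>_def \<beta>_def\<close>)
  then show ?thesis unfolding eq .
qed

text \<open>The norm of x is negative, so it is the negative of the conjugate that is a positive
  rational multiple of 1/x. This exchanges the roles of \<open>a\<close>, \<open>e\<close> with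
  those of \<open>b\<close>, \<open>f\<close>.\<close>

lemma ratio_attainable_if_conj_neg:
  assumes a: "a \<in> \<rat>" and b: "b \<in> \<rat>" and p: "p \<in> \<rat>" "p > 0" "sqrt p \<notin> \<rat>"
    and x_pos: "a + b * sqrt p > 0"
    and x': "a - b * sqrt p < 0" and ef: "e \<in> \<rat>" "f \<in> \<rat>" and f_pos: "f > 0"
    and le: "\<bar>e\<bar> / f \<le> \<bar>a\<bar> / b" and y_pos: "e + f * sqrt p > 0"
  shows "ratio_attainable (a + b * sqrt p) (e + f * sqrt p)"
proof -
  let ?x = "a + b * sqrt p" and ?x' = "a - b * sqrt p"
  have "b * sqrt p > 0" using x' x_pos by simp
  moreover have "sqrt p > 0" using p by simp
  ultimately have b0: "b > 0" by (simp add: zero_less_mult_iff)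
  have "ratio_attainable ?x ((p * b\<^sup>2 - a\<^sup>2) * (1 / ?x))"
  proof (rule ratio_attainable_rat_mult)
    show "ratio_attainable ?x (1 / ?x)"
      using ratio_attainable_inverse ratio_attainable_self x_pos by blast
    show "p * b\<^sup>2 - a\<^sup>2 \<in> \<rat>" using a b p by simp
    show "p * b\<^sup>2 - a\<^sup>2 > 0"
      using mult_pos_neg[OF x_pos x'] sqrt_conj_product[of p a b] p(2) by simp
  qed
  moreover have "(p * b\<^sup>2 - a\<^sup>2) * (1 / ?x) = - ?x'"
  proof -
    have "p * b\<^sup>2 - a\<^sup>2 = - ?x' * ?x" using sqrt_conj_product[of p a b] p(2) by (simp add: algebra_simps)
    then show ?thesis using x_pos by simp
  qed
  ultimately have att: "ratio_attainable ?x (- ?x')" by simp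
  have ef_le: "\<bar>e\<bar> * b \<le> \<bar>a\<bar> * f" using f_pos le b0 by (simp add: field_simps)
  define \<alpha> \<beta> where "\<alpha> = (f / b + e / a) / 2" and "\<beta> = (f / b - e / a) / 2"
  have "\<bar>e / a\<bar> \<le> f / b"
  proof (cases "a = 0")
    case False
    then show ?thesis using ef_le b0 by (simp add: field_simps abs_divide)
  qed (use f_pos b0 in simp)
  then have "\<alpha> \<ge> 0 \<and> \<beta> \<ge> 0" unfolding \<alpha>_def \<beta>_def abs_le_iff by auto
  then have nn: "\<alpha> \<ge> 0" "\<beta> \<ge> 0" by auto
  \<comment> \<open>If \<open>a = 0\<close>, then \<open>ef_le\<close> forces
    \<open>e = 0\<close>.\<close>
  have "(e / a) * a = e"
    using ef_le b0 by (cases "a = 0") (simp_all add: mult_le_0_iff)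
  then have "(e / a) * a + (f / b) * b * sqrt p = e + f * sqrt p" using b0 by simp
  moreover have "\<alpha> * ?x + \<beta> * - ?x' = (e / a) * a + (f / b) * b * sqrt p"
  proof -
    have "\<alpha> + \<beta> = f / b" "\<alpha> - \<beta> = e / a" by (simp_all add: \<alpha>_def \<beta>_def field_simps)
    moreover have "\<alpha> * ?x + \<beta> * - ?x' = (\<alpha> - \<beta>) * a + (\<alpha> + \<beta>) * b * sqrt p"
      by (simp add: algebra_simps)
    ultimately show ?thesis by simp
  qed
  ultimately have eq: "\<alpha> * ?x + \<beta> * - ?x' = e + f * sqrt p" by simp
  have "ratio_attainable ?x (\<alpha> * ?x + \<beta> * - ?x')"
    using ratio_attainable_self[OF x_pos] att
    by (rule ratio_attainable_rat_combination) (use a b ef y_pos nn eq in \<open>simp_all add: \<alpha>_def \<beta>_def\<close>)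
  then show ?thesis unfolding eq .
qed

section \<open>Directions of the tiles\<close>

text \<open>\<open>rot a \<bullet> b\<close> is the determinant of the pair \<open>a\<close>,
  \<open>b\<close>, so Cramer's rule yields the only possible common point.\<close>

lemma finite_Int_nonparallel_lines:
  fixes a b :: "real^2"
  assumes "rot a \<bullet> b \<noteq> 0"
  shows "finite {z. z \<bullet> a = c \<and> z \<bullet> b = d}"
proof -
  define e where "e = a$1 * b$2 - a$2 * b$1"
  have e: "e \<noteq> 0" using assms by (simp add: e_def inner_2 algebra_simps)
  have "z = vector [(c * b$2 - d * a$2) / e, (d * a$1 - c * b$1) / e]"
    if "z \<bullet> a = c" "z \<bullet> b = d" for z
  proof -
    have "c * b$2 - d * a$2 = z$1 * e" "d * a$1 - c * b$1 = z$2 * e"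
      unfolding e_def that[symmetric] inner_2 by (simp_all add: algebra_simps)
    then show ?thesis using e by (simp add: vec_eq_iff forall_2)
  qed
  then have "{z. z \<bullet> a = c \<and> z \<bullet> b = d} \<subseteq> {vector [(c * b$2 - d * a$2) / e, (d * a$1 - c * b$1) / e]}"
    by blast
  then show ?thesis by (rule finite_subset) simp
qed

text \<open>The orbit under quarter turns. As a set it is a canonical label: unit vectors describe
  parallel tiles, up to swapping the sides, precisely when their orbits agree.\<close>

definition orbit :: "real^2 \<Rightarrow> (real^2) set" where
  "orbit u = {u, - u, rot u, - rot u}"

lemma orbit_eq: "v \<in> orbit u \<Longrightarrow> orbit v = orbit u"
  by (auto simp: orbit_def rot_rot rot_minus)

lemma orbit_self: "u \<in> orbit u"
  by (simp add: orbit_def)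

text \<open>Up to sign, the two products are the determinants of \<open>v\<close> with
  \<open>rot u\<close> and with \<open>u\<close>, so \<open>v\<close> is parallel to
  neither.\<close>

lemma not_in_orbit_nonparallel:
  assumes "norm u = 1" "norm v = 1" "v \<notin> orbit u"
  shows "u \<bullet> v \<noteq> 0" "rot u \<bullet> v \<noteq> 0"
proof -
  show "u \<bullet> v \<noteq> 0" using orthonormal_cases[OF assms(1,2)] assms(3) by (auto simp: orbit_def)
  have "norm (rot u) = 1" using assms by simp
  then show "rot u \<bullet> v \<noteq> 0"
    using orthonormal_cases[OF _ assms(2), of "rot u"] assms(3) by (auto simp: orbit_def rot_rot)
qed

lemma frontier_tile_subset:
  assumes "norm u = 1" "tile u l w R"
  obtains c d c' d' where
    "frontier R \<subseteq> {z. z \<bullet> u = c} \<union> {z. z \<bullet> u = d} \<union> {z. z \<bullet> rot u = c'} \<union> {z. z \<bullet> rot u = d'}"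
proof -
  obtain \<alpha> \<beta> where
    R: "R = {z. \<alpha> \<le> z \<bullet> u \<and> z \<bullet> u \<le> \<alpha> + l \<and> \<beta> \<le> z \<bullet> rot u \<and> z \<bullet> rot u \<le> \<beta> + w}"
    using assms by (auto simp: tile_def)
  have "frontier R = R - interior R"
    using tile_sets[OF assms] by (simp add: frontier_def)
  then have "frontier R \<subseteq> {z. z \<bullet> u = \<alpha>} \<union> {z. z \<bullet> u = \<alpha> + l} \<union> {z. z \<bullet> rot u = \<beta>} \<union> {z. z \<bullet> rot u = \<beta> + w}"
    unfolding R interior_tile[OF assms(1)] by auto
  then show ?thesis by (rule that)
qed

text \<open>Each frontier lies on four lines, and every line of one tile crosses every line of the
  other in at most one point.\<close>

lemma finite_frontier_Int_nonaligned:
  assumes "norm u = 1" "tile u l w R" "norm v = 1" "tile v l' w' S" "v \<notin> orbit u"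
  shows "finite (frontier R \<inter> frontier S)"
proof -
  have nz: "u \<bullet> v \<noteq> 0" "rot u \<bullet> v \<noteq> 0" using not_in_orbit_nonparallel assms by auto
  then have nz': "rot u \<bullet> rot v \<noteq> 0" "rot (rot u) \<bullet> v \<noteq> 0" "rot (rot u) \<bullet> rot v \<noteq> 0"
    by (simp_all add: inner_2 algebra_simps)
  note fin = finite_Int_nonparallel_lines[OF nz(2)] finite_Int_nonparallel_lines[OF nz'(1)]
    finite_Int_nonparallel_lines[OF nz'(2)] finite_Int_nonparallel_lines[OF nz'(3)]
  obtain c1 d1 c2 d2 where R:
    "frontier R \<subseteq> {z. z \<bullet> u = c1} \<union> {z. z \<bullet> u = d1} \<union> {z. z \<bullet> rot u = c2} \<union> {z. z \<bullet> rot u = d2}"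
    using frontier_tile_subset[OF assms(1,2)] .
  obtain c1' d1' c2' d2' where S:
    "frontier S \<subseteq> {z. z \<bullet> v = c1'} \<union> {z. z \<bullet> v = d1'} \<union> {z. z \<bullet> rot v = c2'} \<union> {z. z \<bullet> rot v = d2'}"
    using frontier_tile_subset[OF assms(3,4)] .
  show ?thesis
    by (rule finite_subset[OF Int_mono[OF R S]])
       (simp add: Int_Un_distrib Int_Un_distrib2 Collect_conj_eq[symmetric] fin)
qed

text \<open>An open set that misses \<open>interior S\<close> also misses its closure, which is
  \<open>S\<close>.\<close>

lemma Int_subset_frontier:
  fixes R S :: "(real^2) set"
  assumes "closure (interior R) = R" "closure (interior S) = S" "interior R \<inter> interior S = {}"
  shows "R \<inter> S \<subseteq> frontier R \<inter> frontier S"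
proof -
  have "interior R \<inter> S = {}" "interior S \<inter> R = {}"
    using open_Int_closure_eq_empty[OF open_interior, of R "interior S"]
      open_Int_closure_eq_empty[OF open_interior, of S "interior R"] assms by auto
  then show ?thesis using closure_subset[of R] closure_subset[of S] by (auto simp: frontier_def)
qed

text \<open>The plane minus a finite set is connected, so it cannot be separated by the frontier
  into points inside and outside a bounded \<open>H\<close>.\<close>

lemma infinite_frontier:
  fixes H :: "(real^2) set"
  assumes "bounded H" "interior H \<noteq> {}"
  shows "infinite (frontier H)"
proof
  assume fin: "finite (frontier H)"
  have "connected (UNIV - frontier H)"
    by (rule connected_open_delete_finite) (use fin in auto)
  moreover have "(UNIV - frontier H) \<inter> H \<noteq> {}"
    using assms(2) interior_subset[of H] by (auto simp: frontier_def)
  moreover have "(UNIV - frontier H) - H \<noteq> {}"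
  proof
    assume "(UNIV - frontier H) - H = {}"
    then have "UNIV = frontier H \<union> H" by blast
    then have "bounded (UNIV :: (real^2) set)" using assms(1) fin by (metis bounded_Un finite_imp_bounded)
    then show False using not_bounded_UNIV by blast
  qed
  ultimately show False using connected_Int_frontier[of "UNIV - frontier H" H] by blast
qed

text \<open>Directions and sides are functions on the tiles, so that tiles can be sorted by
  direction and summed over.\<close>

definition tiling :: "(real^2) set set \<Rightarrow> ((real^2) set \<Rightarrow> real^2) \<Rightarrow> ((real^2) set \<Rightarrow> real) \<Rightarrow>
    ((real^2) set \<Rightarrow> real) \<Rightarrow> bool" where
  "tiling D U L W \<longleftrightarrow> finite D \<and> (\<forall>R\<in>D. norm (U R) = 1 \<and> tile (U R) (L R) (W R) R) \<and>
     pairwise (\<lambda>R S. interior R \<inter> interior S = {}) D"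

text \<open>Two tiles of different direction classes have disjoint interiors, so they meet only in
  their frontiers, hence in finitely many points.\<close>

lemma aligned_part_facts:
  fixes u :: "real^2"
  assumes "tiling D U L W"
  defines "A \<equiv> \<Union>{R\<in>D. U R \<in> orbit u}" and "B \<equiv> \<Union>{R\<in>D. U R \<notin> orbit u}"
  shows "closed A" "closed B" "bounded A" "finite (A \<inter> B)" "A \<union> B = \<Union>D"
proof -
  have D: "finite D" "\<And>R. R \<in> D \<Longrightarrow> norm (U R) = 1 \<and> tile (U R) (L R) (W R) R"
    "pairwise (\<lambda>R S. interior R \<inter> interior S = {}) D"
    using assms(1) by (auto simp: tiling_def)
  have "closed R" "bounded R" if "R \<in> D" for R
    using D(2)[OF that] tile_sets by blast+
  then show "closed A" "closed B" "bounded A"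
    unfolding A_def B_def using D(1) by (auto intro!: closed_Union bounded_Union)
  show "A \<union> B = \<Union>D" unfolding A_def B_def by blast
  have "finite (R \<inter> S)" if "R \<in> D" "S \<in> D" "U R \<in> orbit u" "U S \<notin> orbit u" for R S
  proof -
    have "R \<noteq> S" using that by auto
    then have "interior R \<inter> interior S = {}" using D(3) that by (auto simp: pairwise_def)
    then have "R \<inter> S \<subseteq> frontier R \<inter> frontier S"
      using Int_subset_frontier tile_sets(4) D(2) that by metis
    moreover have "finite (frontier R \<inter> frontier S)"
      using finite_frontier_Int_nonaligned D(2) that orbit_eq by metis
    ultimately show ?thesis by (rule finite_subset)
  qed
  then have "finite (\<Union>R\<in>{R\<in>D. U R \<in> orbit u}. \<Union>S\<in>{R\<in>D. U R \<notin> orbit u}. R \<inter> S)"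
    using D(1) by (intro finite_UN_I) auto
  moreover have "A \<inter> B = (\<Union>R\<in>{R\<in>D. U R \<in> orbit u}. \<Union>S\<in>{R\<in>D. U R \<notin> orbit u}. R \<inter> S)"
    unfolding A_def B_def by blast
  ultimately show "finite (A \<inter> B)" by simp
qed

text \<open>The part of the first tiling aligned with \<open>u\<close> cannot overlap the part \<open>B'\<close> of the second
  tiling not aligned with \<open>u\<close>: up to finitely many points, the frontier of their common part
  would consist of crossings of nonparallel sides, so it would be finite.\<close>

lemma aligned_part_subset:
  assumes "tiling D1 U1 L1 W1" "tiling D2 U2 L2 W2" "\<Union>D1 = \<Union>D2"
  shows "\<Union>{R\<in>D1. U1 R \<in> orbit u} \<subseteq> \<Union>{R\<in>D2. U2 R \<in> orbit u}"
proof (rule ccontr)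
  define A where "A = \<Union>{R\<in>D1. U1 R \<in> orbit u}"
  define A' where "A' = \<Union>{R\<in>D1. U1 R \<notin> orbit u}"
  define B where "B = \<Union>{R\<in>D2. U2 R \<in> orbit u}"
  define B' where "B' = \<Union>{R\<in>D2. U2 R \<notin> orbit u}"
  define M where "M = \<Union>D1"
  note f1 = aligned_part_facts[OF assms(1), of u, folded A_def A'_def M_def]
  note f2 = aligned_part_facts[OF assms(2), of u, folded B_def B'_def assms(3) M_def]
  have D1: "finite D1" "\<And>R. R \<in> D1 \<Longrightarrow> norm (U1 R) = 1 \<and> tile (U1 R) (L1 R) (W1 R) R"
    using assms(1) by (auto simp: tiling_def)
  have D2: "finite D2" "\<And>R. R \<in> D2 \<Longrightarrow> norm (U2 R) = 1 \<and> tile (U2 R) (L2 R) (W2 R) R"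
    using assms(2) by (auto simp: tiling_def)
  assume "\<not> \<Union>{R\<in>D1. U1 R \<in> orbit u} \<subseteq> \<Union>{R\<in>D2. U2 R \<in> orbit u}"
  then obtain R where R: "R \<in> D1" "U1 R \<in> orbit u" "\<not> R \<subseteq> B" by (auto simp: B_def)
  \<comment> \<open>\<open>B\<close> is closed, so it would otherwise contain the closure
    \<open>R\<close> of \<open>interior R\<close>.\<close>
  have "\<not> interior R \<subseteq> B"
    using R tile_sets(4) D1(2) f2(1) closure_minimal by metis
  define H where "H = A \<inter> B'"
  have "interior R - B \<subseteq> H"
  proof -
    have "interior R \<subseteq> A" using R interior_subset by (auto simp: A_def)
    then show ?thesis using f1(5) f2(5) by (auto simp: H_def)
  qed
  moreover have "open (interior R - B)" using f2(1) by blast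
  ultimately have "interior R - B \<subseteq> interior H" by (rule interior_maximal)
  with \<open>\<not> interior R \<subseteq> B\<close> have "interior H \<noteq> {}" by blast
  moreover have "bounded H" using f1(3) by (auto simp: H_def intro: bounded_subset)
  ultimately have inf: "infinite (frontier H)" by (intro infinite_frontier)
  have "closed H" using f1 f2 by (auto simp: H_def)
  let ?X = "\<Union>S\<in>{R\<in>D1. U1 R \<in> orbit u}. \<Union>T\<in>{R\<in>D2. U2 R \<notin> orbit u}. frontier S \<inter> frontier T"
  have "frontier H \<subseteq> (A \<inter> A') \<union> (B \<inter> B') \<union> ?X"
  proof
    fix q assume q: "q \<in> frontier H"
    then have qH: "q \<in> A" "q \<in> B'" "q \<notin> interior H"
      using \<open>closed H\<close> by (auto simp: frontier_def H_def)
    show "q \<in> (A \<inter> A') \<union> (B \<inter> B') \<union> ?X"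
    proof (cases "q \<in> A' \<or> q \<in> B")
      case True then show ?thesis using qH by blast
    next
      case False
      \<comment> \<open>Points of \<open>M\<close> off \<open>A'\<close> and \<open>B\<close> lie in
        both \<open>A\<close> and \<open>B'\<close>. Hence \<open>q\<close> cannot be interior to
        \<open>M\<close>, and every tile through \<open>q\<close> has it on its frontier.\<close>
      have "interior M - A' - B \<subseteq> H"
        using interior_subset[of M] f1(5) f2(5) by (auto simp: H_def)
      moreover have "open (interior M - A' - B)" using f1 f2 by blast
      ultimately have "interior M - A' - B \<subseteq> interior H" by (rule interior_maximal)
      then have qM: "q \<notin> interior M" using False qH by blast
      have fr: "q \<in> frontier S" if "q \<in> S" "S \<subseteq> M" for S
        using that qM interior_mono[of S M] closure_subset[of S] by (auto simp: frontier_def)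
      obtain S T where S: "S \<in> D1" "U1 S \<in> orbit u" "q \<in> S" and T: "T \<in> D2" "U2 T \<notin> orbit u" "q \<in> T"
        using qH by (auto simp: A_def B'_def)
      then have "q \<in> frontier S \<inter> frontier T"
        using fr assms(3) by (auto simp: M_def)
      then show ?thesis using S T by blast
    qed
  qed
  moreover have "finite ((A \<inter> A') \<union> (B \<inter> B') \<union> ?X)"
  proof -
    have "finite (frontier S \<inter> frontier T)"
      if "S \<in> D1" "U1 S \<in> orbit u" "T \<in> D2" "U2 T \<notin> orbit u" for S T
      using finite_frontier_Int_nonaligned D1(2) D2(2) that orbit_eq by metis
    then have "finite ?X" using D1(1) D2(1) by (intro finite_UN_I) auto
    then show ?thesis using f1(4) f2(4) by simp
  qed
  ultimately show False using inf finite_subset by blast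
qed

section \<open>Invariance of the sums\<close>

text \<open>Each product expands into a weighted sum over the sample points in the tile. After
  exchanging the sums, the result depends on \<open>D\<close> only through its union.\<close>

lemma sum_sides_eq_grid_sum:
  assumes u: "norm u = 1" and D: "finite D" "pairwise (\<lambda>R S. interior R \<inter> interior S = {}) D"
    and R: "\<And>R. R \<in> D \<Longrightarrow> R = {z. \<alpha> R \<le> z \<bullet> u \<and> z \<bullet> u \<le> \<alpha> R + L R \<and>
              \<beta> R \<le> z \<bullet> rot u \<and> z \<bullet> rot u \<le> \<beta> R + W R}"
    and P: "finite P" "\<And>R. R \<in> D \<Longrightarrow> \<alpha> R \<notin> P \<and> \<alpha> R + L R \<notin> P"
      "\<And>R. R \<in> D \<Longrightarrow> f (L R) = (\<Sum>m\<in>{m\<in>P. \<alpha> R < m \<and> m < \<alpha> R + L R}. \<omega> m)"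
    and Q: "finite Q" "\<And>R. R \<in> D \<Longrightarrow> \<beta> R \<notin> Q \<and> \<beta> R + W R \<notin> Q"
      "\<And>R. R \<in> D \<Longrightarrow> f (W R) = (\<Sum>n\<in>{n\<in>Q. \<beta> R < n \<and> n < \<beta> R + W R}. \<eta> n)"
  shows "(\<Sum>R\<in>D. f (L R) * f (W R)) =
    (\<Sum>m\<in>P. \<Sum>n\<in>Q. if m *\<^sub>R u + n *\<^sub>R rot u \<in> \<Union>D then \<omega> m * \<eta> n else (0::real))"
proof -
  define z where "z m n = m *\<^sub>R u + n *\<^sub>R rot u" for m n
  have z: "z m n \<bullet> u = m" "z m n \<bullet> rot u = n" for m n
    using orthonormal_coords[OF u] by (simp_all add: z_def)
  have zR: "z m n \<in> R \<longleftrightarrow> \<alpha> R < m \<and> m < \<alpha> R + L R \<and> \<beta> R < n \<and> n < \<beta> R + W R"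
    "z m n \<in> R \<Longrightarrow> z m n \<in> interior R"
    if "R \<in> D" "m \<in> P" "n \<in> Q" for R m n
  proof -
    have "z m n \<in> R \<longleftrightarrow> \<alpha> R \<le> m \<and> m \<le> \<alpha> R + L R \<and> \<beta> R \<le> n \<and> n \<le> \<beta> R + W R"
      by (subst R[OF that(1)]) (simp add: z)
    moreover have ne: "\<alpha> R \<noteq> m" "\<alpha> R + L R \<noteq> m" "\<beta> R \<noteq> n" "\<beta> R + W R \<noteq> n"
      using P(2) Q(2) that by auto
    ultimately show zR: "z m n \<in> R \<longleftrightarrow> \<alpha> R < m \<and> m < \<alpha> R + L R \<and> \<beta> R < n \<and> n < \<beta> R + W R"
      using ne[symmetric] by (simp only: less_le simp_thms)
    have "interior R = {z. \<alpha> R < z \<bullet> u \<and> z \<bullet> u < \<alpha> R + L R \<and> \<beta> R < z \<bullet> rot u \<and> z \<bullet> rot u < \<beta> R + W R}"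
      by (subst R[OF that(1)]) (rule interior_tile[OF u])
    then show "z m n \<in> R \<Longrightarrow> z m n \<in> interior R" using zR by (simp add: z)
  qed
  have prod: "f (L R) * f (W R) = (\<Sum>m\<in>P. \<Sum>n\<in>Q. if z m n \<in> R then \<omega> m * \<eta> n else 0)"
    if "R \<in> D" for R
  proof -
    have "f (L R) * f (W R) = (\<Sum>m\<in>P. \<Sum>n\<in>Q. (if \<alpha> R < m \<and> m < \<alpha> R + L R then \<omega> m else 0) *
        (if \<beta> R < n \<and> n < \<beta> R + W R then \<eta> n else 0))"
      unfolding P(3)[OF that] Q(3)[OF that] sum.inter_filter[OF P(1)] sum.inter_filter[OF Q(1)]
      by (rule sum_product)
    also have "\<dots> = (\<Sum>m\<in>P. \<Sum>n\<in>Q. if z m n \<in> R then \<omega> m * \<eta> n else 0)"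
      by (intro sum.cong refl) (simp add: zR(1)[OF that])
    finally show ?thesis .
  qed
  \<comment> \<open>A sample point lies in the interior of any tile containing it, so it belongs to
    at most one tile.\<close>
  have count: "(\<Sum>R\<in>D. if z m n \<in> R then c else 0) = (if z m n \<in> \<Union>D then c else (0::real))"
    if "m \<in> P" "n \<in> Q" for m n c
  proof (cases "z m n \<in> \<Union>D")
    case False
    then show ?thesis by (auto intro: sum.neutral)
  next
    case True
    then obtain S where S: "S \<in> D" "z m n \<in> S" by blast
    have "z m n \<in> R \<longleftrightarrow> R = S" if "R \<in> D" for R
      using zR(2)[OF _ \<open>m \<in> P\<close> \<open>n \<in> Q\<close>] S that D(2) unfolding pairwise_def by blast
    then have "(\<Sum>R\<in>D. if z m n \<in> R then c else 0) = (\<Sum>R\<in>D. if R = S then c else 0)"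
      by (intro sum.cong) auto
    then show ?thesis using True S D(1) by simp
  qed
  have "(\<Sum>R\<in>D. f (L R) * f (W R)) = (\<Sum>R\<in>D. \<Sum>m\<in>P. \<Sum>n\<in>Q. if z m n \<in> R then \<omega> m * \<eta> n else 0)"
    using prod by simp
  also have "\<dots> = (\<Sum>m\<in>P. \<Sum>R\<in>D. \<Sum>n\<in>Q. if z m n \<in> R then \<omega> m * \<eta> n else 0)"
    by (rule sum.swap)
  also have "\<dots> = (\<Sum>m\<in>P. \<Sum>n\<in>Q. \<Sum>R\<in>D. if z m n \<in> R then \<omega> m * \<eta> n else 0)"
    by (intro sum.cong refl sum.swap)
  also have "\<dots> = (\<Sum>m\<in>P. \<Sum>n\<in>Q. if z m n \<in> \<Union>D then \<omega> m * \<eta> n else 0)"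
    by (intro sum.cong refl) (rule count)
  finally show ?thesis by (simp add: z_def)
qed

lemma parallel_tilings_sum_eq:
  assumes u: "norm u = 1" and f: "Modules.additive (f :: real \<Rightarrow> real)"
    and D1: "finite D1" "pairwise (\<lambda>R S. interior R \<inter> interior S = {}) D1"
      "\<And>R. R \<in> D1 \<Longrightarrow> tile u (L1 R) (W1 R) R"
    and D2: "finite D2" "pairwise (\<lambda>R S. interior R \<inter> interior S = {}) D2"
      "\<And>R. R \<in> D2 \<Longrightarrow> tile u (L2 R) (W2 R) R"
    and eq: "\<Union>D1 = \<Union>D2"
  shows "(\<Sum>R\<in>D1. f (L1 R) * f (W1 R)) = (\<Sum>R\<in>D2. f (L2 R) * f (W2 R))"
proof -
  have "\<forall>R\<in>D1. \<exists>\<alpha> \<beta>. R = {z. \<alpha> \<le> z \<bullet> u \<and> z \<bullet> u \<le> \<alpha> + L1 R \<and>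
      \<beta> \<le> z \<bullet> rot u \<and> z \<bullet> rot u \<le> \<beta> + W1 R}"
    using D1(3) unfolding tile_def by blast
  from bchoice[OF this] obtain \<alpha>1 where "\<forall>R\<in>D1. \<exists>\<beta>. R = {z. \<alpha>1 R \<le> z \<bullet> u \<and> z \<bullet> u \<le> \<alpha>1 R + L1 R \<and>
      \<beta> \<le> z \<bullet> rot u \<and> z \<bullet> rot u \<le> \<beta> + W1 R}" by blast
  from bchoice[OF this] obtain \<beta>1 where
    "\<forall>R\<in>D1. R = {z. \<alpha>1 R \<le> z \<bullet> u \<and> z \<bullet> u \<le> \<alpha>1 R + L1 R \<and>
      \<beta>1 R \<le> z \<bullet> rot u \<and> z \<bullet> rot u \<le> \<beta>1 R + W1 R}" by blast
  then have R1: "R = {z. \<alpha>1 R \<le> z \<bullet> u \<and> z \<bullet> u \<le> \<alpha>1 R + L1 R \<and>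
      \<beta>1 R \<le> z \<bullet> rot u \<and> z \<bullet> rot u \<le> \<beta>1 R + W1 R}"
    if "R \<in> D1" for R using that by (rule bspec)
  have "\<forall>R\<in>D2. \<exists>\<alpha> \<beta>. R = {z. \<alpha> \<le> z \<bullet> u \<and> z \<bullet> u \<le> \<alpha> + L2 R \<and>
      \<beta> \<le> z \<bullet> rot u \<and> z \<bullet> rot u \<le> \<beta> + W2 R}"
    using D2(3) unfolding tile_def by blast
  from bchoice[OF this] obtain \<alpha>2 where "\<forall>R\<in>D2. \<exists>\<beta>. R = {z. \<alpha>2 R \<le> z \<bullet> u \<and> z \<bullet> u \<le> \<alpha>2 R + L2 R \<and>
      \<beta> \<le> z \<bullet> rot u \<and> z \<bullet> rot u \<le> \<beta> + W2 R}" by blast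
  from bchoice[OF this] obtain \<beta>2 where
    "\<forall>R\<in>D2. R = {z. \<alpha>2 R \<le> z \<bullet> u \<and> z \<bullet> u \<le> \<alpha>2 R + L2 R \<and>
      \<beta>2 R \<le> z \<bullet> rot u \<and> z \<bullet> rot u \<le> \<beta>2 R + W2 R}" by blast
  then have R2: "R = {z. \<alpha>2 R \<le> z \<bullet> u \<and> z \<bullet> u \<le> \<alpha>2 R + L2 R \<and>
      \<beta>2 R \<le> z \<bullet> rot u \<and> z \<bullet> rot u \<le> \<beta>2 R + W2 R}"
    if "R \<in> D2" for R using that by (rule bspec)
  \<comment> \<open>The edge coordinates of both tilings enter one grid, so that both sums are
    evaluated at the same sample points with the same weights.\<close>
  define X where "X = \<alpha>1 ` D1 \<union> (\<lambda>R. \<alpha>1 R + L1 R) ` D1 \<union> \<alpha>2 ` D2 \<union> (\<lambda>R. \<alpha>2 R + L2 R) ` D2"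
  define Y where "Y = \<beta>1 ` D1 \<union> (\<lambda>R. \<beta>1 R + W1 R) ` D1 \<union> \<beta>2 ` D2 \<union> (\<lambda>R. \<beta>2 R + W2 R) ` D2"
  have "finite X" "finite Y" using D1 D2 by (simp_all add: X_def Y_def)
  obtain P \<omega> where P: "finite P" "P \<inter> X = {}"
    "\<And>a b. a \<in> X \<Longrightarrow> b \<in> X \<Longrightarrow> a \<le> b \<Longrightarrow> f (b - a) = (\<Sum>m\<in>{m\<in>P. a < m \<and> m < b}. \<omega> m)"
    using grid_sum_exists[OF f \<open>finite X\<close>] by blast
  obtain Q \<eta> where Q: "finite Q" "Q \<inter> Y = {}"
    "\<And>a b. a \<in> Y \<Longrightarrow> b \<in> Y \<Longrightarrow> a \<le> b \<Longrightarrow> f (b - a) = (\<Sum>m\<in>{m\<in>Q. a < m \<and> m < b}. \<eta> m)"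
    using grid_sum_exists[OF f \<open>finite Y\<close>] by blast
  have XY1: "\<alpha>1 R \<in> X" "\<alpha>1 R + L1 R \<in> X" "\<beta>1 R \<in> Y" "\<beta>1 R + W1 R \<in> Y" "L1 R > 0" "W1 R > 0"
    if "R \<in> D1" for R using that D1(3)[OF that] by (auto simp: X_def Y_def tile_def)
  have XY2: "\<alpha>2 R \<in> X" "\<alpha>2 R + L2 R \<in> X" "\<beta>2 R \<in> Y" "\<beta>2 R + W2 R \<in> Y" "L2 R > 0" "W2 R > 0"
    if "R \<in> D2" for R using that D2(3)[OF that] by (auto simp: X_def Y_def tile_def)
  have side1: "f (L1 R) = (\<Sum>m\<in>{m\<in>P. \<alpha>1 R < m \<and> m < \<alpha>1 R + L1 R}. \<omega> m)"
    "f (W1 R) = (\<Sum>n\<in>{n\<in>Q. \<beta>1 R < n \<and> n < \<beta>1 R + W1 R}. \<eta> n)"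
    "\<alpha>1 R \<notin> P \<and> \<alpha>1 R + L1 R \<notin> P" "\<beta>1 R \<notin> Q \<and> \<beta>1 R + W1 R \<notin> Q" if "R \<in> D1" for R
    using P(3)[OF XY1(1,2)[OF that]] Q(3)[OF XY1(3,4)[OF that]] XY1[OF that] P(2) Q(2)
    by auto
  have side2: "f (L2 R) = (\<Sum>m\<in>{m\<in>P. \<alpha>2 R < m \<and> m < \<alpha>2 R + L2 R}. \<omega> m)"
    "f (W2 R) = (\<Sum>n\<in>{n\<in>Q. \<beta>2 R < n \<and> n < \<beta>2 R + W2 R}. \<eta> n)"
    "\<alpha>2 R \<notin> P \<and> \<alpha>2 R + L2 R \<notin> P" "\<beta>2 R \<notin> Q \<and> \<beta>2 R + W2 R \<notin> Q" if "R \<in> D2" for R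
    using P(3)[OF XY2(1,2)[OF that]] Q(3)[OF XY2(3,4)[OF that]] XY2[OF that] P(2) Q(2)
    by auto
  have "(\<Sum>R\<in>D1. f (L1 R) * f (W1 R)) =
      (\<Sum>m\<in>P. \<Sum>n\<in>Q. if m *\<^sub>R u + n *\<^sub>R rot u \<in> \<Union>D1 then \<omega> m * \<eta> n else 0)"
    by (rule sum_sides_eq_grid_sum[OF u D1(1,2) R1 P(1) side1(3,1) Q(1) side1(4,2)])
  also have "\<dots> = (\<Sum>R\<in>D2. f (L2 R) * f (W2 R))"
    unfolding eq
    by (rule sum_sides_eq_grid_sum[OF u D2(1,2) R2 P(1) side2(3,1) Q(1) side2(4,2), symmetric])
  finally show ?thesis .
qed

lemma aligned_tile_cases:
  assumes "tile v l w R" "v \<in> orbit u"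
  shows "tile u l w R \<or> tile u w l R"
proof -
  consider "v = u" | "- v = u" | "- rot v = u" | "rot v = u"
    using assms(2) by (auto simp: orbit_def rot_rot rot_minus)
  then show ?thesis
    using assms(1) tile_uminus[OF assms(1)] tile_rot[OF assms(1)]
      tile_uminus[OF tile_rot[OF assms(1)]] by cases simp_all
qed

text \<open>Tiles are grouped by direction class. Within a class the two tilings cover the same set,
  by \<open>aligned_part_subset\<close> in both directions, which reduces the claim to parallel
  tilings.\<close>

lemma tiling_sum_eq:
  fixes f :: "real \<Rightarrow> real"
  assumes "Modules.additive f"
    and T1: "tiling D1 U1 L1 W1" and T2: "tiling D2 U2 L2 W2" and eq: "\<Union>D1 = \<Union>D2"
  shows "(\<Sum>R\<in>D1. f (L1 R) * f (W1 R)) = (\<Sum>R\<in>D2. f (L2 R) * f (W2 R))"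
proof -
  define K where "K = (\<lambda>R. orbit (U1 R)) ` D1 \<union> (\<lambda>R. orbit (U2 R)) ` D2"
  have D: "finite D1" "finite D2" "finite K"
    using T1 T2 by (auto simp: tiling_def K_def)
  have class_eq: "(\<Sum>R\<in>{R\<in>D1. orbit (U1 R) = k}. f (L1 R) * f (W1 R)) =
        (\<Sum>R\<in>{R\<in>D2. orbit (U2 R) = k}. f (L2 R) * f (W2 R))" if "k \<in> K" for k
  proof -
    have "\<exists>u. norm u = 1 \<and> k = orbit u"
      using that
    proof (unfold K_def, elim UnE imageE)
      fix R assume "R \<in> D1" "k = orbit (U1 R)"
      then show ?thesis using T1 by (auto simp: tiling_def)
    next
      fix R assume "R \<in> D2" "k = orbit (U2 R)"
      then show ?thesis using T2 by (auto simp: tiling_def)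
    qed
    then obtain u where u: "norm u = 1" "k = orbit u" by blast
    have k: "orbit v = k \<longleftrightarrow> v \<in> orbit u" for v
      using orbit_eq[of v u] orbit_self[of v] unfolding u(2) by auto
    \<comment> \<open>Describing a tile with respect to \<open>u\<close> may interchange its sides,
      but their product under \<open>f\<close> is symmetric.\<close>
    have flip: "\<exists>L' W'. \<forall>R\<in>{R\<in>D. U R \<in> orbit u}. tile u (L' R) (W' R) R \<and>
        f (L' R) * f (W' R) = f (L R) * f (W R)"
      if "tiling D U L W" for D U L W
    proof -
      have "\<exists>l w. tile u l w R \<and> f l * f w = f (L R) * f (W R)"
        if "R \<in> {R\<in>D. U R \<in> orbit u}" for R
      proof -
        have "tile u (L R) (W R) R \<or> tile u (W R) (L R) R"
          using \<open>tiling D U L W\<close> that by (intro aligned_tile_cases[of "U R"]) (auto simp: tiling_def)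
        then show ?thesis
        proof
          assume "tile u (L R) (W R) R" then show ?thesis by blast
        next
          assume "tile u (W R) (L R) R" then show ?thesis using mult.commute by blast
        qed
      qed
      then have "\<forall>R\<in>{R\<in>D. U R \<in> orbit u}. \<exists>l w. tile u l w R \<and> f l * f w = f (L R) * f (W R)"
        by blast
      from bchoice[OF this] obtain L' where "\<forall>R\<in>{R\<in>D. U R \<in> orbit u}. \<exists>w. tile u (L' R) w R \<and>
          f (L' R) * f w = f (L R) * f (W R)" by blast
      from bchoice[OF this] show ?thesis by blast
    qed
    obtain L1' W1' where LW1: "\<And>R. R \<in> {R\<in>D1. U1 R \<in> orbit u} \<Longrightarrow> tile u (L1' R) (W1' R) R \<and>
        f (L1' R) * f (W1' R) = f (L1 R) * f (W1 R)" using flip[OF T1] by blast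
    obtain L2' W2' where LW2: "\<And>R. R \<in> {R\<in>D2. U2 R \<in> orbit u} \<Longrightarrow> tile u (L2' R) (W2' R) R \<and>
        f (L2' R) * f (W2' R) = f (L2 R) * f (W2 R)" using flip[OF T2] by blast
    have "(\<Sum>R\<in>{R\<in>D1. U1 R \<in> orbit u}. f (L1' R) * f (W1' R)) =
          (\<Sum>R\<in>{R\<in>D2. U2 R \<in> orbit u}. f (L2' R) * f (W2' R))"
    proof (rule parallel_tilings_sum_eq[OF u(1) assms(1)])
      show "\<Union>{R\<in>D1. U1 R \<in> orbit u} = \<Union>{R\<in>D2. U2 R \<in> orbit u}"
        using aligned_part_subset[OF T1 T2 eq] aligned_part_subset[OF T2 T1 eq[symmetric]]
        by (rule equalityI)
      show "finite {R\<in>D1. U1 R \<in> orbit u}" "finite {R\<in>D2. U2 R \<in> orbit u}"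
        using D by simp_all
      show "pairwise (\<lambda>R S. interior R \<inter> interior S = {}) {R\<in>D1. U1 R \<in> orbit u}"
        "pairwise (\<lambda>R S. interior R \<inter> interior S = {}) {R\<in>D2. U2 R \<in> orbit u}"
        using T1 T2 by (auto simp: tiling_def pairwise_def)
    qed (use LW1 LW2 in blast)+
    moreover have "(\<Sum>R\<in>{R\<in>D1. U1 R \<in> orbit u}. f (L1' R) * f (W1' R)) =
        (\<Sum>R\<in>{R\<in>D1. U1 R \<in> orbit u}. f (L1 R) * f (W1 R))"
      using LW1 by (intro sum.cong) blast+
    moreover have "(\<Sum>R\<in>{R\<in>D2. U2 R \<in> orbit u}. f (L2' R) * f (W2' R)) =
        (\<Sum>R\<in>{R\<in>D2. U2 R \<in> orbit u}. f (L2 R) * f (W2 R))"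
      using LW2 by (intro sum.cong) blast+
    ultimately show ?thesis by (simp only: k)
  qed
  have "(\<Sum>R\<in>D1. f (L1 R) * f (W1 R)) = (\<Sum>k\<in>K. \<Sum>R\<in>{R\<in>D1. orbit (U1 R) = k}. f (L1 R) * f (W1 R))"
    by (rule sum.group[OF D(1,3), symmetric]) (simp add: K_def)
  also have "\<dots> = (\<Sum>k\<in>K. \<Sum>R\<in>{R\<in>D2. orbit (U2 R) = k}. f (L2 R) * f (W2 R))"
    by (intro sum.cong refl class_eq)
  also have "\<dots> = (\<Sum>R\<in>D2. f (L2 R) * f (W2 R))"
    by (rule sum.group[OF D(2,3)]) (simp add: K_def)
  finally show ?thesis .
qed

lemma rectangle_dissection_imp_tiling:
  assumes "rectangle_dissection D M" "\<And>R. R \<in> D \<Longrightarrow> rectangle (L R) (W R) R"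
  obtains U where "tiling D U L W"
proof -
  have "\<exists>u. norm u = 1 \<and> tile u (L R) (W R) R" if "R \<in> D" for R
    using rectangle_imp_tile[OF assms(2)[OF that]] by metis
  then obtain U where "\<And>R. R \<in> D \<Longrightarrow> norm (U R) = 1 \<and> tile (U R) (L R) (W R) R" by metis
  then have "tiling D U L W" using assms(1) by (auto simp: tiling_def rectangle_dissection_def)
  then show ?thesis by (rule that)
qed

lemma rectangle_dissections_sum_eq:
  fixes f :: "real \<Rightarrow> real"
  assumes "Modules.additive f"
    and "rectangle_dissection D1 M" "\<And>R. R \<in> D1 \<Longrightarrow> rectangle (L1 R) (W1 R) R"
    and "rectangle_dissection D2 M" "\<And>R. R \<in> D2 \<Longrightarrow> rectangle (L2 R) (W2 R) R"
  shows "(\<Sum>R\<in>D1. f (L1 R) * f (W1 R)) = (\<Sum>R\<in>D2. f (L2 R) * f (W2 R))"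
proof -
  obtain U1 where "tiling D1 U1 L1 W1" using rectangle_dissection_imp_tiling[OF assms(2,3)] .
  moreover obtain U2 where "tiling D2 U2 L2 W2" using rectangle_dissection_imp_tiling[OF assms(4,5)] .
  moreover have "\<Union>D1 = \<Union>D2" using assms(2,4) by (simp add: rectangle_dissection_def)
  ultimately show ?thesis using assms(1) by (intro tiling_sum_eq)
qed

section \<open>Comparison of two dissections\<close>

lemma dissectable_if_ratio_attainable:
  assumes "rectangle_dissection D M" "\<And>R. R \<in> D \<Longrightarrow> has_side_ratio y R" "ratio_attainable x y"
  shows "dissectable_with_ratio x M"
proof -
  have "dissectable_with_ratio x R" if "R \<in> D" for R
    using assms(2)[OF that] assms(3) unfolding has_side_ratio_def ratio_attainable_def by blast
  then have "dissectable_with_ratio x (\<Union>D)"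
    using assms(1) by (intro dissectable_Union) (auto simp: rectangle_dissection_def)
  then show ?thesis using assms(1) by (simp add: rectangle_dissection_def)
qed

text \<open>A vertex of a boundary line lies on the frontier of \<open>M\<close>. This ensures that
  the given dissection has a tile, whence the number of tiles and \<open>y\<close> are
  positive.\<close>

lemma polygon_nonempty:
  assumes "polygon_bounded_by C M" shows "M \<noteq> {}"
proof -
  obtain vs where vs: "vs \<in> C" "simple_closed_polygonal_line vs"
    using assms by (auto simp: polygon_bounded_by_def)
  then have "length vs \<ge> 3" by (simp only: simple_closed_polygonal_line_def)
  then have "0 < length vs" by linarith
  then have "vs ! 0 \<in> polygonal_line vs"
    by (auto simp: polygonal_line_def side_def side_ends_def intro!: bexI[of _ 0])
  then have "frontier M \<noteq> {}" using assms vs(1) by (auto simp: polygon_bounded_by_def)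
  then show ?thesis by auto
qed

text \<open>Congruent tiles of equal ratio have a common side \<open>w\<close>. Invariance is
  applied to \<open>g\<close> composed with division by \<open>w\<close>, so that every tile of
  \<open>D\<close> contributes \<open>g 1 * g y\<close>.\<close>

lemma dissections_sums_eq:
  assumes D: "rectangle_dissection D M" "D \<noteq> {}" "\<And>R. R \<in> D \<Longrightarrow> has_side_ratio y R"
      "\<And>R S. R \<in> D \<Longrightarrow> S \<in> D \<Longrightarrow> congruent_sets R S"
    and E: "rectangle_dissection E M" "\<And>R. R \<in> E \<Longrightarrow> has_side_ratio x R"
  obtains t where "\<And>g. Modules.additive g \<Longrightarrow>
    (\<Sum>R\<in>E. g (t R) * g (x * t R)) = real (card D) * (g 1 * g y :: real)"
proof -
  have "\<forall>R\<in>D. \<exists>s. s > 0 \<and> rectangle s (y * s) R" using D(3) by (auto simp: has_side_ratio_def)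
  from bchoice[OF this] obtain d where d: "\<And>R. R \<in> D \<Longrightarrow> d R > 0 \<and> rectangle (d R) (y * d R) R"
    by blast
  have "\<forall>R\<in>E. \<exists>s. s > 0 \<and> rectangle s (x * s) R" using E(2) by (auto simp: has_side_ratio_def)
  from bchoice[OF this] obtain s where s: "\<And>R. R \<in> E \<Longrightarrow> s R > 0 \<and> rectangle (s R) (x * s R) R"
    by blast
  obtain R0 where R0: "R0 \<in> D" using D(2) by blast
  define w where "w = d R0"
  have w: "w > 0" using d R0 by (simp add: w_def)
  have dw: "d R = w" if "R \<in> D" for R
    unfolding w_def using that R0 d D(4) congruent_same_ratio_sides_le by (meson antisym)
  have "(\<Sum>R\<in>E. g (s R / w) * g (x * (s R / w))) = real (card D) * (g 1 * g y)"
    if g: "Modules.additive g" for g :: "real \<Rightarrow> real"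
  proof -
    have "Modules.additive (\<lambda>z. g (z / w))"
      using g by (simp add: Modules.additive_def add_divide_distrib)
    then have "(\<Sum>R\<in>E. g (s R / w) * g (x * s R / w)) = (\<Sum>R\<in>D. g (d R / w) * g (y * d R / w))"
      by (rule rectangle_dissections_sum_eq[OF _ E(1) _ D(1)]) (use s d in blast)+
    also have "\<dots> = (\<Sum>R\<in>D. g 1 * g y)" using w by (intro sum.cong) (simp_all add: dw)
    finally show ?thesis by simp
  qed
  then show ?thesis by (rule that)
qed

theorem mainTheorem2:
  fixes a b p y :: real and C :: "(real^2) list set" and M :: "(real^2) set"
  assumes "a \<in> \<rat>" and "b \<in> \<rat>" and "p \<in> \<rat>"
    and "p > 0" and "sqrt p \<notin> \<rat>" and "a + b * sqrt p > 0"
    and "polygon_bounded_by C M"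
    and "polygon_side_lengths C \<subseteq> rat_adjoin_sqrt p"
    and "dissectable_into_equal_with_ratio y M"
  shows "(a - b * sqrt p > 0 \<longrightarrow>
            (dissectable_with_ratio (a + b * sqrt p) M \<longleftrightarrow>
             y \<in> {e + f * sqrt p | e f.
                    e \<in> \<rat> \<and> f \<in> \<rat> \<and> e > 0 \<and> \<bar>f\<bar> / e \<le> \<bar>b\<bar> / a})) \<and>
         (a - b * sqrt p < 0 \<longrightarrow>
            (dissectable_with_ratio (a + b * sqrt p) M \<longleftrightarrow>
             y \<in> {e + f * sqrt p | e f.
                    e \<in> \<rat> \<and> f \<in> \<rat> \<and> f > 0 \<and> \<bar>e\<bar> / f \<le> \<bar>a\<bar> / b}))"
proof -
  obtain D where D: "rectangle_dissection D M" "\<And>R. R \<in> D \<Longrightarrow> has_side_ratio y R"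
      "\<And>R S. R \<in> D \<Longrightarrow> S \<in> D \<Longrightarrow> congruent_sets R S"
    using assms(9) unfolding dissectable_into_equal_with_ratio_def by blast
  have D0: "D \<noteq> {}" using polygon_nonempty[OF assms(7)] D(1) by (auto simp: rectangle_dissection_def)
  have N: "real (card D) > 0" using D0 D(1) by (simp add: rectangle_dissection_def card_gt_0_iff)
  obtain R where "R \<in> D" using D0 by blast
  then have "y > 0" using D(2)[of R] by (auto simp: has_side_ratio_def rectangle_def zero_less_mult_iff)
  \<comment> \<open>For sufficiency each tile of \<open>D\<close> is cut separately.\<close>
  note sufficient = dissectable_if_ratio_attainable[OF D(1,2)]
  have necessary: "\<exists>e f. e \<in> \<rat> \<and> f \<in> \<rat> \<and> y = e + f * sqrt p \<and>
      (a - b * sqrt p > 0 \<longrightarrow> e > 0 \<and> \<bar>f\<bar> / e \<le> \<bar>b\<bar> / a) \<and>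
      (a - b * sqrt p < 0 \<longrightarrow> f > 0 \<and> \<bar>e\<bar> / f \<le> \<bar>a\<bar> / b)"
    if dis: "dissectable_with_ratio (a + b * sqrt p) M"
  proof -
    obtain E where E: "rectangle_dissection E M" "\<And>R. R \<in> E \<Longrightarrow> has_side_ratio (a + b * sqrt p) R"
      using dis unfolding dissectable_with_ratio_def by blast
    obtain t where t: "\<And>g. Modules.additive g \<Longrightarrow>
      (\<Sum>R\<in>E. g (t R) * g ((a + b * sqrt p) * t R)) = real (card D) * (g 1 * g y :: real)"
      using dissections_sums_eq[OF D(1) D0 D(2,3) E] by blast
    show ?thesis
    proof (rule ratio_necessary[OF assms(1-6) N \<open>y > 0\<close> t])
      fix e f
      assume "e \<in> \<rat>" "f \<in> \<rat>" "y = e + f * sqrt p"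
        and "a - b * sqrt p > 0 \<Longrightarrow> e > 0 \<and> \<bar>f\<bar> / e \<le> \<bar>b\<bar> / a"
        and "a - b * sqrt p < 0 \<Longrightarrow> f > 0 \<and> \<bar>e\<bar> / f \<le> \<bar>a\<bar> / b"
      then show ?thesis by (intro exI[of _ e] exI[of _ f] conjI impI) simp_all
    qed
  qed
  show ?thesis
  proof (intro conjI impI iffI)
    assume "a - b * sqrt p > 0" "dissectable_with_ratio (a + b * sqrt p) M"
    then show "y \<in> {e + f * sqrt p | e f. e \<in> \<rat> \<and> f \<in> \<rat> \<and> e > 0 \<and> \<bar>f\<bar> / e \<le> \<bar>b\<bar> / a}"
      using necessary by blast
  next
    assume "a - b * sqrt p < 0" "dissectable_with_ratio (a + b * sqrt p) M"
    then show "y \<in> {e + f * sqrt p | e f. e \<in> \<rat> \<and> f \<in> \<rat> \<and> f > 0 \<and> \<bar>e\<bar> / f \<le> \<bar>a\<bar> / b}"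
      using necessary by blast
  next
    assume "a - b * sqrt p > 0"
      and "y \<in> {e + f * sqrt p | e f. e \<in> \<rat> \<and> f \<in> \<rat> \<and> e > 0 \<and> \<bar>f\<bar> / e \<le> \<bar>b\<bar> / a}"
    then show "dissectable_with_ratio (a + b * sqrt p) M"
      using ratio_attainable_if_conj_pos[OF assms(1-6)] \<open>y > 0\<close> by (intro sufficient) blast+
  next
    assume "a - b * sqrt p < 0"
      and "y \<in> {e + f * sqrt p | e f. e \<in> \<rat> \<and> f \<in> \<rat> \<and> f > 0 \<and> \<bar>e\<bar> / f \<le> \<bar>a\<bar> / b}"
    then show "dissectable_with_ratio (a + b * sqrt p) M"
      using ratio_attainable_if_conj_neg[OF assms(1-6)] \<open>y > 0\<close> by (intro sufficient) blast+
  qed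
qed

end
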